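(* Assume that $g,\varphi\in\mathcal{H}ol(\mathbb{C})$, $\alpha>0$ and $0<q\le\infty$. Then the following properties are equivalent: (i) $T_g^\varphi:\mathcal{F}_\alpha^\infty(\mathbb{C})\to\mathcal{F}_\alpha^q(\mathbb{C})$ is a bounded operator; (ii) $$\frac{1+|\varphi(z)|}{1+|z|}\,|g(z)|\,e^{\frac{\alpha}{2}(|\varphi(z)|^2-|z|^2)}\in L^q(\mathbb{C},\nu_1).$$
   Context: $\mathcal{H}ol(\mathbb{C})$ is the space of entire functions on $\mathbb{C}$ and $\nu_1$ is Lebesgue (area) measure on $\mathbb{C}$. For $0<q<\infty$, the Fock space $\mathcal{F}_\alpha^q(\mathbb{C})$ consists of those $f\in\mathcal{H}ol(\mathbb{C})$ with $\|f\|_{\mathcal{F}_\alpha^q}^q=\frac{\alpha q}{2\pi}\int_{\mathbb{C}}|f(z)|^q e^{-\frac{\alpha q}{2}|z|^2}\,d\nu_1(z)<\infty$; $\mathcal{F}_\alpha^\infty(\mathbb{C})$ consists of those $f\in\mathcal{H}ol(\mathbb{C})$ with $\|f\|_{\mathcal{F}_\alpha^\infty}=\sup_{z\in\mathbb{C}}|f(z)|e^{-\frac{\alpha}{2}|z|^2}<\infty$. The operator $T_g^\varphi$ is defined by $T_g^\varphi f(z)=\int_0^z f'(\varphi(\xi))\,g(\xi)\,d\xi$, $f\in\mathcal{H}ol(\mathbb{C})$, $z\in\mathbb{C}$, where $f'(\varphi(\xi))$ is the derivative of $f$ evaluated at $\varphi(\xi)$. *)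

theory Defs
  imports "HOL-Complex_Analysis.Complex_Analysis"
begin

text \<open>
  Exponents range over \<^typ>\<open>ennreal\<close>, so that the case \<open>q = \<infinity>\<close> is included.
  The area measure on the complex plane is \<^term>\<open>lborel :: complex measure\<close>; all functions to
  which it is applied below are continuous, so that completing it would make no difference.
\<close>

definition fock_space :: "real \<Rightarrow> ennreal \<Rightarrow> (complex \<Rightarrow> complex) set" where
  "fock_space \<alpha> q = {f. f holomorphic_on UNIV \<and>
     (if q = \<infinity>
      then bdd_above (range (\<lambda>z. norm (f z) * exp (- (\<alpha> / 2) * (norm z)\<^sup>2)))
      else integrable lborel
             (\<lambda>z. norm (f z) powr enn2real q * exp (- (\<alpha> * enn2real q / 2) * (norm z)\<^sup>2)))}"

text \<open>
  The (quasi-)norm. The real-valued supremum and integral are meaningful only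
  for \<^term>\<open>f \<in> fock_space \<alpha> q\<close>.
\<close>

definition fock_norm :: "real \<Rightarrow> ennreal \<Rightarrow> (complex \<Rightarrow> complex) \<Rightarrow> real" where
  "fock_norm \<alpha> q f =
     (if q = \<infinity>
      then (SUP z. norm (f z) * exp (- (\<alpha> / 2) * (norm z)\<^sup>2))
      else (\<alpha> * enn2real q / (2 * pi) *
             (LINT z|lborel. norm (f z) powr enn2real q
                * exp (- (\<alpha> * enn2real q / 2) * (norm z)\<^sup>2))) powr (1 / enn2real q))"

definition T_op :: "(complex \<Rightarrow> complex) \<Rightarrow> (complex \<Rightarrow> complex) \<Rightarrow>
    (complex \<Rightarrow> complex) \<Rightarrow> complex \<Rightarrow> complex" where
  "T_op g \<phi> f z = contour_integral (linepath 0 z) (\<lambda>\<xi>. deriv f (\<phi> \<xi>) * g \<xi>)"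

definition fock_bounded_operator ::
    "real \<Rightarrow> ennreal \<Rightarrow> ennreal \<Rightarrow> ((complex \<Rightarrow> complex) \<Rightarrow> complex \<Rightarrow> complex) \<Rightarrow> bool" where
  "fock_bounded_operator \<alpha> p q T \<longleftrightarrow>
     (\<forall>f\<in>fock_space \<alpha> p. T f \<in> fock_space \<alpha> q) \<and>
     (\<forall>f\<in>fock_space \<alpha> p. \<forall>h\<in>fock_space \<alpha> p. T (\<lambda>z. f z + h z) = (\<lambda>z. T f z + T h z)) \<and>
     (\<forall>f\<in>fock_space \<alpha> p. \<forall>c. T (\<lambda>z. c * f z) = (\<lambda>z. c * T f z)) \<and>
     (\<exists>C. \<forall>f\<in>fock_space \<alpha> p. fock_norm \<alpha> q (T f) \<le> C * fock_norm \<alpha> p f)"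

definition in_Lq :: "'a measure \<Rightarrow> ennreal \<Rightarrow> ('a \<Rightarrow> real) \<Rightarrow> bool" where
  "in_Lq M q f \<longleftrightarrow> f \<in> borel_measurable M \<and>
     (if q = \<infinity> then (\<exists>C. AE x in M. \<bar>f x\<bar> \<le> C)
      else integrable M (\<lambda>x. \<bar>f x\<bar> powr enn2real q))"

end

theory Submission
  imports Defs
begin

text \<open>
  The derivative of \<open>T f\<close> is \<open>(f' \<circ> \<phi>) g\<close>, so a Littlewood--Paley description of the Fock
  spaces, \<open>F w \<in> L\<^sup>q\<close> iff \<open>F' w / (1 + |z|) \<in> L\<^sup>q\<close>
  for \<open>F 0 = 0\<close> and the Gaussian weight \<open>w z = exp (- \<alpha> |z|\<^sup>2 / 2)\<close>, reduces membership of \<open>T f\<close> in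
  the target space to an \<open>L\<^sup>q\<close> condition on the weighted derivative of \<open>f\<close> at \<open>\<phi> z\<close> times the
  function in (ii). That weighted derivative is bounded by the norm of \<open>f\<close>, which gives (ii) implies (i).
  Conversely there are finitely many functions in the growth space whose weighted derivatives
  have no common region of smallness, and already their images under \<open>T\<close> force (ii).

  To cover \<open>q < 1\<close>, both halves of the Littlewood--Paley equivalence rest on a local mean value
  inequality at the scale \<open>1 / (1 + |z|)\<close> and on a Schur test for an exponentially decaying kernel.
\<close>

section \<open>Local estimates\<close>

text \<open>On a disc of radius 1 / (1 + |z|) about z the Gaussian weight changes by a bounded
  factor only, and there Cauchy's estimate costs the factor 1 + |z|. This fixes the scale. For q < 1
  the integral of F' along the segment from 0 to z cannot be moved through the L^q quasi-norm by
  Minkowski's inequality. Instead F is bounded pointwise: all values of F' on the segment are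
  controlled by one average centred at z. At the point s z this loses, up to a constant, exp (const
  * (1 - s) |z|^2), which the Gaussian gain along the segment outweighs if the kernel decays slowly
  enough. Only then is |F'|^q integrated. A single test function cannot give the converse. If the
  weighted derivative of f were bounded below, f' would have no zeros, so log |f'| would be harmonic
  with constant means over circles about 0, yet it would grow like \<alpha> |z|^2 / 2. This forces a
  family, and its size depends on \<alpha>.\<close>

text \<open>
  For \<open>q < 1\<close> convexity is not available. Instead, at a maximum point of
  \<open>(r - |\<omega> - z|) powr (2/q) * |h \<omega>|\<close> the function \<open>h\<close> is comparable to its value on a disc of
  proportional radius, by Cauchy's estimate.
\<close>

lemma powr_norm_le_nn_integral_ball:
  fixes q :: real
  assumes q: "q > 0"
  obtains C where "C \<ge> 0"
    "\<And>h z r. h holomorphic_on UNIV \<Longrightarrow> r > 0 \<Longrightarrow>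
       ennreal (norm (h z) powr q * r\<^sup>2)
         \<le> ennreal C * (\<integral>\<^sup>+\<omega>\<in>ball z r. ennreal (norm (h \<omega>) powr q) \<partial>lborel)"
proof
  \<comment> \<open>Within \<open>\<rho>\<close> of the maximum point the factor
    \<open>r - dist z \<omega>\<close> is at least half of its value there; \<open>K\<close> is what
    this half costs after the power 2/q.\<close>
  define K :: real where "K = 2 powr (2/q)"
  have K1: "K \<ge> 1" unfolding K_def using q by (intro ge_one_powr_ge_zero) auto
  define C where "C = 4 * 2 powr q * 16 * K\<^sup>2 / pi"
  show C0: "C \<ge> 0" unfolding C_def by simp
  fix h z and r :: real
  assume hol: "h holomorphic_on UNIV" and r: "r > 0"
  note cont = holomorphic_on_imp_continuous_on[OF hol]
  let ?I = "\<integral>\<^sup>+\<omega>\<in>ball z r. ennreal (norm (h \<omega>) powr q) \<partial>lborel"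
  show "ennreal (norm (h z) powr q * r\<^sup>2) \<le> ennreal C * ?I"
  proof (cases "h z = 0")
    case True
    then show ?thesis using q by simp
  next
    case False
    \<comment> \<open>The exponent 2/q makes the q-th power of \<open>m\<close> carry (r - |z -
      \<omega>|)^2, the order of the area of the disc found around the maximum point.\<close>
    define m where "m \<omega> = (r - dist z \<omega>) powr (2/q) * norm (h \<omega>)" for \<omega>
    have "continuous_on (cball z r) m"
      unfolding m_def using q
      by (intro continuous_intros continuous_on_powr' continuous_on_subset[OF cont]) auto
    then obtain z0 where z0: "z0 \<in> cball z r" and max: "\<And>\<omega>. \<omega> \<in> cball z r \<Longrightarrow> m \<omega> \<le> m z0"
      using continuous_attains_sup[of "cball z r" m] r by auto
    have "0 < m z" using False r by (simp add: m_def)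
    also have le: "m z \<le> m z0" using max r by simp
    finally have m0: "m z0 > 0" .
    define \<rho> where "\<rho> = (r - dist z z0) / 2"
    have \<rho>: "\<rho> > 0" and hz0: "norm (h z0) > 0"
      using m0 z0 unfolding m_def \<rho>_def by (auto simp: zero_less_mult_iff)
    have r\<rho>: "r - dist z z0 = 2 * \<rho>" unfolding \<rho>_def by simp
    have K: "norm (h \<omega>) \<le> K * norm (h z0)" if "dist z0 \<omega> \<le> \<rho>" for \<omega>
    proof -
      have d: "\<rho> \<le> r - dist z \<omega>" using that r\<rho> dist_triangle[of z \<omega> z0] by simp
      have "\<rho> powr (2/q) * norm (h \<omega>) \<le> m \<omega>"
        unfolding m_def using d \<rho> q by (intro mult_right_mono powr_mono2) auto
      also have "m \<omega> \<le> m z0" using max d \<rho> by simp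
      also have "m z0 = \<rho> powr (2/q) * (K * norm (h z0))"
        unfolding m_def r\<rho> K_def using \<rho> by (simp add: powr_mult)
      finally show ?thesis using \<rho> by (simp add: mult_le_cancel_left_pos)
    qed
    have der: "norm (deriv h \<omega>) \<le> 2 * K * norm (h z0) / \<rho>" if "\<omega> \<in> ball z0 (\<rho>/2)" for \<omega>
    proof -
      have "norm ((deriv ^^ 1) h \<omega>) \<le> fact 1 * (K * norm (h z0)) / (\<rho>/2) ^ 1"
      proof (rule Cauchy_inequality)
        show "h holomorphic_on ball \<omega> (\<rho>/2)" "continuous_on (cball \<omega> (\<rho>/2)) h"
          using hol cont by (auto intro: holomorphic_on_subset continuous_on_subset)
        show "\<rho>/2 > 0" using \<rho> by simp
        fix x assume "norm (\<omega> - x) = \<rho>/2"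
        then show "norm (h x) \<le> K * norm (h z0)"
          using that dist_triangle[of z0 x \<omega>] by (intro K) (simp add: dist_norm)
      qed
      then show ?thesis by (simp add: field_simps)
    qed
    \<comment> \<open>With this radius the bound on the derivative times \<open>s\<close> is half of
      \<open>norm (h z0)\<close>, so \<open>h\<close> keeps at least half of its size at
      \<open>z0\<close>.\<close>
    define s where "s = \<rho> / (4 * K)"
    have "s > 0" "\<rho> / (4 * K) \<le> \<rho> / 4"
      unfolding s_def using \<rho> K1 by (simp, intro divide_left_mono, auto)
    then have s: "s > 0" "s \<le> \<rho>/4" unfolding s_def by simp_all
    have low: "norm (h z0) / 2 \<le> norm (h \<omega>)" if \<omega>: "\<omega> \<in> ball z0 s" for \<omega>
    proof -
      have "norm (h \<omega> - h z0) \<le> (2 * K * norm (h z0) / \<rho>) * norm (\<omega> - z0)"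
      proof (rule field_differentiable_bound[where S="ball z0 (\<rho>/2)" and f'="deriv h"])
        show "(h has_field_derivative deriv h x) (at x within ball z0 (\<rho>/2))"
          if "x \<in> ball z0 (\<rho>/2)" for x
          by (rule has_field_derivative_at_within[OF holomorphic_derivI[OF hol]]) auto
        show "norm (deriv h x) \<le> 2 * K * norm (h z0) / \<rho>" if "x \<in> ball z0 (\<rho>/2)" for x
          by (rule der[OF that])
        show "\<omega> \<in> ball z0 (\<rho>/2)" "z0 \<in> ball z0 (\<rho>/2)"
          using \<omega> s(2) \<rho> by simp_all
      qed simp
      also have "\<dots> \<le> (2 * K * norm (h z0) / \<rho>) * s"
        using \<omega> \<rho> K1 by (intro mult_left_mono) (auto simp: dist_norm norm_minus_commute)
      also have "\<dots> = norm (h z0) / 2" unfolding s_def using \<rho> K1 by (simp add: field_simps)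
      finally show ?thesis using norm_triangle_ineq2[of "h z0" "h \<omega>"]
        by (simp add: norm_minus_commute)
    qed
    have sub: "ball z0 s \<subseteq> ball z r"
      using s r\<rho> \<rho> by (intro ball_subset_ball_iff[THEN iffD2]) (auto simp: dist_commute)
    have pw: "norm (h z) powr q * r\<^sup>2 \<le> norm (h z0) powr q * (2 * \<rho>)\<^sup>2"
    proof -
      have eq: "m z1 powr q = (r - dist z z1)\<^sup>2 * norm (h z1) powr q" if "r - dist z z1 > 0" for z1
        unfolding m_def using that q by (simp add: powr_mult powr_powr)
      have "m z powr q \<le> m z0 powr q" using le \<open>0 < m z\<close> q by (intro powr_mono2) auto
      then show ?thesis using r r\<rho> \<rho> by (simp add: eq mult.commute)
    qed
    have "ennreal ((norm (h z0) / 2) powr q * (pi * s\<^sup>2))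
        = (\<integral>\<^sup>+\<omega>. ennreal ((norm (h z0) / 2) powr q) * indicator (ball z0 s) \<omega> \<partial>lborel)"
      using s by (subst nn_integral_cmult_indicator)
        (auto simp: emeasure_ball unit_ball_vol_2 ennreal_mult)
    also have "\<dots> \<le> ?I"
      using low sub q by (intro nn_integral_mono) (auto split: split_indicator intro!: ennreal_leI powr_mono2)
    finally have I: "ennreal ((norm (h z0) / 2) powr q * (pi * s\<^sup>2)) \<le> ?I" .
    have "norm (h z0) powr q * (2 * \<rho>)\<^sup>2 = C * ((norm (h z0) / 2) powr q * (pi * s\<^sup>2))"
      unfolding C_def s_def using K1 by (simp add: powr_divide field_simps power2_eq_square)
    then have "ennreal (norm (h z) powr q * r\<^sup>2) \<le> ennreal C * ennreal ((norm (h z0) / 2) powr q * (pi * s\<^sup>2))"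
      using pw C0 by (simp add: ennreal_mult'[symmetric] ennreal_leI)
    also have "\<dots> \<le> ennreal C * ?I" by (intro mult_left_mono I) simp
    finally show ?thesis .
  qed
qed

text \<open>The exponent \<open>s\<close> lets one estimate serve both sides of the
  Littlewood--Paley equivalence: 0 for a function, 1 for its derivative.\<close>

definition fw :: "real \<Rightarrow> nat \<Rightarrow> (complex \<Rightarrow> complex) \<Rightarrow> complex \<Rightarrow> real" where
  "fw \<alpha> s h z = norm (h z) / (1 + norm z) ^ s * exp (- (\<alpha> / 2) * (norm z)\<^sup>2)"

text \<open>
  Moving \<open>\<omega>\<close> by \<open>O(1 / (1 + |z|))\<close> changes the kernel by a constant factor only, and its integral in \<open>z\<close> is bounded,
  the area of a disc of radius \<open>1 / (1 + |\<omega>|)\<close> cancelling the factor in front.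
\<close>

definition bump :: "real \<Rightarrow> complex \<Rightarrow> complex \<Rightarrow> real" where
  "bump c z \<omega> = (1 + norm \<omega>)\<^sup>2 * exp (- c * (1 + norm z) * dist z \<omega>)"

lemma fw_nonneg [simp]: "0 \<le> fw \<alpha> s h z"
  by (simp add: fw_def)

lemma bump_nonneg [simp]: "0 \<le> bump c z \<omega>"
  by (simp add: bump_def)

lemma continuous_fw [continuous_intros]:
  assumes "h holomorphic_on UNIV"
  shows "continuous_on UNIV (fw \<alpha> s h)"
  unfolding fw_def using holomorphic_on_imp_continuous_on[OF assms]
  by (intro continuous_intros) (auto simp: add_nonneg_eq_0_iff)

lemma entire_measurable:
  fixes h :: "complex \<Rightarrow> complex"
  assumes "h holomorphic_on UNIV"
  shows "h \<in> borel_measurable borel"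
  using holomorphic_on_imp_continuous_on[OF assms] by (rule borel_measurable_continuous_onI)

lemma fw_measurable [measurable]:
  assumes "h holomorphic_on UNIV"
  shows "fw \<alpha> s h \<in> borel_measurable borel"
  using continuous_fw[OF assms] by (rule borel_measurable_continuous_onI)

lemma bump_measurable [measurable]:
  "case_prod (bump c) \<in> borel_measurable (lborel \<Otimes>\<^sub>M lborel)"
  unfolding bump_def by measurable

text \<open>The kernel is centred at \<open>z\<close>, the value is taken at another point
  \<open>\<zeta>\<close>: one average controls the values everywhere, at the price of an exponential
  in the distance. On the disc of radius 1 / (1 + |\<zeta>|) the weight is comparable to a constant,
  so the mean value inequality passes to \<open>fw\<close>, and the kernel is bounded below
  there.\<close>

lemma fw_powr_le_bump_average:
  assumes q: "q > 0" and \<alpha>: "\<alpha> > 0" and c: "c > 0"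
  obtains C where "C \<ge> 0"
    "\<And>h z \<zeta>. h holomorphic_on UNIV \<Longrightarrow> ennreal (fw \<alpha> s h \<zeta> powr q) \<le>
       ennreal (C * exp (2 * c * (1 + norm z) * dist z \<zeta>)) *
       (\<integral>\<^sup>+\<omega>. ennreal (fw \<alpha> s h \<omega> powr q) * ennreal (bump c z \<omega>) \<partial>lborel)"
proof -
  obtain C0 where C0: "C0 \<ge> 0" and loc:
    "\<And>h z r. h holomorphic_on UNIV \<Longrightarrow> r > 0 \<Longrightarrow>
       ennreal (norm (h z) powr q * r\<^sup>2)
         \<le> ennreal C0 * (\<integral>\<^sup>+\<omega>\<in>ball z r. ennreal (norm (h \<omega>) powr q) \<partial>lborel)"
    using powr_norm_le_nn_integral_ball[OF q] by metis
  \<comment> \<open>The factors compare (1 + |\<zeta>|)^2 with (1 + |\<omega>|)^2, then the weights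
    at \<open>\<zeta>\<close> and \<open>\<omega>\<close>; \<open>exp c\<close> is the constant 1
    left over in the exponent of the kernel.\<close>
  define E where "E = 4 * (2 ^ s * exp (3 * \<alpha> / 2)) powr q * exp c"
  show ?thesis
  proof (rule that[of "C0 * E"])
    show "0 \<le> C0 * E" using C0 by (simp add: E_def)
    fix h and z \<zeta> :: complex assume hol: "h holomorphic_on UNIV"
    have [measurable]: "h \<in> borel_measurable borel" using hol by (rule entire_measurable)
    have [measurable]: "ball a b \<in> sets borel" for a :: complex and b by simp
    define r where "r = 1 / (1 + norm \<zeta>)"
    have r: "r > 0" "r \<le> 1" and rr: "r * (1 + norm \<zeta>) = 1"
      unfolding r_def by (auto simp: divide_simps add_pos_nonneg add_nonneg_eq_0_iff)
    define w where "w = exp (- (\<alpha> / 2) * (norm \<zeta>)\<^sup>2) / (1 + norm \<zeta>) ^ s"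
    have w: "w > 0" unfolding w_def by (simp add: add_pos_nonneg)
    define X where "X = 2 * c * (1 + norm z) * dist z \<zeta>"
    have key: "w powr q * norm (h \<omega>) powr q / r\<^sup>2 \<le> E * exp X * (fw \<alpha> s h \<omega> powr q * bump c z \<omega>)"
      if \<omega>: "\<omega> \<in> ball \<zeta> r" for \<omega> :: complex
    proof -
      have d: "dist \<zeta> \<omega> \<le> r" using \<omega> by simp
      have n1: "norm \<omega> \<le> norm \<zeta> + r" and n2: "norm \<zeta> \<le> norm \<omega> + r"
        using d norm_triangle_ineq2[of \<omega> \<zeta>] norm_triangle_ineq2[of \<zeta> \<omega>]
        by (auto simp: dist_norm norm_minus_commute)
      have a1: "1 + norm \<omega> \<le> 2 * (1 + norm \<zeta>)" and a2: "1 + norm \<zeta> \<le> 2 * (1 + norm \<omega>)"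
        using n1 n2 r by (auto simp: add_nonneg_nonneg) (smt (verit) norm_ge_zero)+
      have "(norm \<omega>)\<^sup>2 \<le> (norm \<zeta> + r)\<^sup>2" using n1 by (intro power_mono) auto
      also have "\<dots> = (norm \<zeta>)\<^sup>2 + 2 * (r * norm \<zeta>) + r * r" by (simp add: power2_eq_square algebra_simps)
      also have "\<dots> \<le> (norm \<zeta>)\<^sup>2 + 3"
      proof -
        have "r * norm \<zeta> \<le> 1" "r * r \<le> 1" using rr r mult_le_one[of r r] by (auto simp: algebra_simps)
        then show ?thesis by linarith
      qed
      finally have sq: "(norm \<omega>)\<^sup>2 \<le> (norm \<zeta>)\<^sup>2 + 3" .
      have "exp (- (\<alpha> / 2) * (norm \<zeta>)\<^sup>2) \<le> exp (3 * \<alpha> / 2 + - (\<alpha> / 2) * (norm \<omega>)\<^sup>2)"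
        using mult_left_mono[OF sq, of "\<alpha>/2"] \<alpha> by (simp add: field_simps)
      moreover have "1 / (1 + norm \<zeta>) ^ s \<le> 2 ^ s / (1 + norm \<omega>) ^ s"
        using power_mono[OF a1, of s] unfolding power_mult_distrib
        by (simp add: divide_simps add_pos_nonneg)
      ultimately have "w \<le> exp (3 * \<alpha> / 2 + - (\<alpha> / 2) * (norm \<omega>)\<^sup>2) * (2 ^ s / (1 + norm \<omega>) ^ s)"
        unfolding w_def using mult_mono
          [of "exp (- (\<alpha> / 2) * (norm \<zeta>)\<^sup>2)" "exp (3 * \<alpha> / 2 + - (\<alpha> / 2) * (norm \<omega>)\<^sup>2)"
              "1 / (1 + norm \<zeta>) ^ s" "2 ^ s / (1 + norm \<omega>) ^ s"] by simp
      then have "w * norm (h \<omega>) \<le>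
          exp (3 * \<alpha> / 2 + - (\<alpha> / 2) * (norm \<omega>)\<^sup>2) * (2 ^ s / (1 + norm \<omega>) ^ s) * norm (h \<omega>)"
        by (rule mult_right_mono) simp
      also have "\<dots> = (2 ^ s * exp (3 * \<alpha> / 2)) * fw \<alpha> s h \<omega>"
        unfolding exp_add fw_def by simp
      finally have "(w * norm (h \<omega>)) powr q \<le> ((2 ^ s * exp (3 * \<alpha> / 2)) * fw \<alpha> s h \<omega>) powr q"
        using w q by (intro powr_mono2) auto
      then have 1: "w powr q * norm (h \<omega>) powr q \<le> (2 ^ s * exp (3 * \<alpha> / 2)) powr q * fw \<alpha> s h \<omega> powr q"
        using w by (simp add: powr_mult)
      have "(1 + norm z) * dist z \<omega> \<le> (1 + norm z) * (dist z \<zeta> + r)"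
        using dist_triangle[of z \<omega> \<zeta>] d by (intro mult_left_mono) auto
      \<comment> \<open>The radius is adapted to \<open>\<zeta>\<close>, not to \<open>z\<close>.
        The excess of |z| over |\<zeta>| costs one more \<open>dist z \<zeta>\<close>, which the
        factor 2 in \<open>X\<close> absorbs.\<close>
      also have "(1 + norm z) * r \<le> (1 + norm \<zeta> + dist z \<zeta>) * r"
        using r norm_triangle_ineq2[of z \<zeta>] by (intro mult_right_mono) (auto simp: dist_norm)
      then have "(1 + norm z) * (dist z \<zeta> + r) \<le> (1 + norm z) * dist z \<zeta> + 1 + dist z \<zeta>"
        using rr r mult_left_le[of r "dist z \<zeta>"] by (simp add: algebra_simps)
      also have "\<dots> \<le> 2 * (1 + norm z) * dist z \<zeta> + 1" by (simp add: algebra_simps)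
      finally have "c * ((1 + norm z) * dist z \<omega>) \<le> c * (2 * (1 + norm z) * dist z \<zeta> + 1)"
        using c by (intro mult_left_mono) auto
      then have ex: "1 \<le> exp c * exp X * exp (- c * (1 + norm z) * dist z \<omega>)"
        unfolding X_def by (simp add: exp_add[symmetric] algebra_simps)
      have "1 / r\<^sup>2 = (1 + norm \<zeta>)\<^sup>2" unfolding r_def by (simp add: power_divide)
      also have "\<dots> \<le> (2 * (1 + norm \<omega>))\<^sup>2" using a2 by (intro power_mono) auto
      also have "\<dots> = 4 * (1 + norm \<omega>)\<^sup>2 * 1" by (simp add: power2_eq_square algebra_simps)
      also have "\<dots> \<le> 4 * (1 + norm \<omega>)\<^sup>2 * (exp c * exp X * exp (- c * (1 + norm z) * dist z \<omega>))"
        by (intro mult_left_mono ex) auto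
      also have "\<dots> = 4 * exp c * exp X * bump c z \<omega>" by (simp add: bump_def)
      finally have 2: "1 / r\<^sup>2 \<le> 4 * exp c * exp X * bump c z \<omega>" .
      show ?thesis using mult_mono[OF 1 2] by (simp add: E_def mult_ac)
    qed
    have "fw \<alpha> s h \<zeta> = w * norm (h \<zeta>)" by (simp add: fw_def w_def)
    then have eq: "fw \<alpha> s h \<zeta> powr q = w powr q / r\<^sup>2 * (norm (h \<zeta>) powr q * r\<^sup>2)"
      using w r by (simp add: powr_mult)
    have "ennreal (w powr q / r\<^sup>2) * (\<integral>\<^sup>+\<omega>\<in>ball \<zeta> r. ennreal (norm (h \<omega>) powr q) \<partial>lborel) =
       (\<integral>\<^sup>+\<omega>. ennreal (w powr q / r\<^sup>2) * (ennreal (norm (h \<omega>) powr q) * indicator (ball \<zeta> r) \<omega>) \<partial>lborel)"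
      by (intro nn_integral_cmult[symmetric]) measurable
    also have "\<dots> \<le> (\<integral>\<^sup>+\<omega>. ennreal (E * exp X) * (ennreal (fw \<alpha> s h \<omega> powr q) * ennreal (bump c z \<omega>)) \<partial>lborel)"
    proof (rule nn_integral_mono)
      fix \<omega> :: complex
      show "ennreal (w powr q / r\<^sup>2) * (ennreal (norm (h \<omega>) powr q) * indicator (ball \<zeta> r) \<omega>)
        \<le> ennreal (E * exp X) * (ennreal (fw \<alpha> s h \<omega> powr q) * ennreal (bump c z \<omega>))"
      proof (cases "\<omega> \<in> ball \<zeta> r")
        case True
        have "E * exp X \<ge> 0" by (simp add: E_def)
        then have "ennreal (E * exp X) * (ennreal (fw \<alpha> s h \<omega> powr q) * ennreal (bump c z \<omega>))
          = ennreal (E * exp X * (fw \<alpha> s h \<omega> powr q * bump c z \<omega>))"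
          by (subst (1 2) ennreal_mult') auto
        moreover have "ennreal (w powr q / r\<^sup>2) * (ennreal (norm (h \<omega>) powr q) * indicator (ball \<zeta> r) \<omega>)
          = ennreal (w powr q * norm (h \<omega>) powr q / r\<^sup>2)"
          using True by (simp flip: ennreal_mult')
        ultimately show ?thesis using ennreal_leI[OF key[OF True]] by simp
      qed simp
    qed
    also have "\<dots> = ennreal (E * exp X) * (\<integral>\<^sup>+\<omega>. ennreal (fw \<alpha> s h \<omega> powr q) * ennreal (bump c z \<omega>) \<partial>lborel)"
      using hol by (intro nn_integral_cmult) measurable
    finally have I: "ennreal (w powr q / r\<^sup>2) * (\<integral>\<^sup>+\<omega>\<in>ball \<zeta> r. ennreal (norm (h \<omega>) powr q) \<partial>lborel)
      \<le> ennreal (E * exp X) * (\<integral>\<^sup>+\<omega>. ennreal (fw \<alpha> s h \<omega> powr q) * ennreal (bump c z \<omega>) \<partial>lborel)" .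
    have "ennreal (fw \<alpha> s h \<zeta> powr q) = ennreal (w powr q / r\<^sup>2) * ennreal (norm (h \<zeta>) powr q * r\<^sup>2)"
      unfolding eq by (rule ennreal_mult') simp
    also have "\<dots> \<le> ennreal (w powr q / r\<^sup>2) * (ennreal C0 * (\<integral>\<^sup>+\<omega>\<in>ball \<zeta> r. ennreal (norm (h \<omega>) powr q) \<partial>lborel))"
      by (intro mult_left_mono loc hol r) simp
    also have "\<dots> = ennreal C0 * (ennreal (w powr q / r\<^sup>2) * (\<integral>\<^sup>+\<omega>\<in>ball \<zeta> r. ennreal (norm (h \<omega>) powr q) \<partial>lborel))"
      by (simp add: mult_ac)
    also have "\<dots> \<le> ennreal C0 * (ennreal (E * exp X) * (\<integral>\<^sup>+\<omega>. ennreal (fw \<alpha> s h \<omega> powr q) * ennreal (bump c z \<omega>) \<partial>lborel))"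
      by (intro mult_left_mono I) simp
    also have "\<dots> = ennreal (C0 * E * exp X) * (\<integral>\<^sup>+\<omega>. ennreal (fw \<alpha> s h \<omega> powr q) * ennreal (bump c z \<omega>) \<partial>lborel)"
      unfolding mult.assoc[of C0] ennreal_mult'[OF C0] by (simp only: mult.assoc)
    finally show "ennreal (fw \<alpha> s h \<zeta> powr q) \<le> ennreal (C0 * E * exp (2 * c * (1 + norm z) * dist z \<zeta>)) *
       (\<integral>\<^sup>+\<omega>. ennreal (fw \<alpha> s h \<omega> powr q) * ennreal (bump c z \<omega>) \<partial>lborel)"
      unfolding X_def .
  qed
qed

section \<open>The Schur test and the Littlewood--Paley inequalities\<close>

text \<open>The exponential is dominated by a sum of weights exp (-n) on discs of radius (n + 1) /
  k, whose areas scale like 1 / k^2 and grow only quadratically in n.\<close>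

lemma nn_integral_exp_norm:
  obtains C where "C \<ge> 0"
    "\<And>k (a::complex). k > 0 \<Longrightarrow> (\<integral>\<^sup>+z. ennreal (exp (- k * dist z a)) \<partial>lborel) \<le> ennreal (C / k\<^sup>2)"
proof
  define A where "A = (\<Sum>n. exp (- real n) * (pi * (1 + real n)\<^sup>2))"
  have sm: "summable (\<lambda>n. exp (- real n) * (pi * (1 + real n)\<^sup>2))"
  proof (rule summable_comparison_test_ev)
    show "summable (\<lambda>n. pi * (exp (-1/2)) ^ n * 16)"
      by (intro summable_mult summable_mult2 summable_geometric) simp
    have "norm (exp (- real n) * (pi * (1 + real n)\<^sup>2)) \<le> pi * (exp (-1/2)) ^ n * 16" for n
    proof -
      have "1 + real n \<le> 4 * exp (real n / 4)" using exp_ge_add_one_self[of "real n / 4"] by linarith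
      then have "(1 + real n)\<^sup>2 \<le> (4 * exp (real n / 4))\<^sup>2" by (intro power_mono) auto
      also have "\<dots> = 16 * exp (real n / 2)"
        by (simp add: power_mult_distrib exp_double[symmetric])
      finally have "exp (- real n) * (pi * (1 + real n)\<^sup>2) \<le> exp (- real n) * (pi * (16 * exp (real n / 2)))"
        by (intro mult_left_mono) auto
      also have "\<dots> = pi * exp (- real n + real n / 2) * 16" unfolding exp_add by simp
      also have "exp (- real n + real n / 2) = (exp (-1/2)) ^ n"
        unfolding exp_of_nat_mult[symmetric] by (simp add: field_simps)
      finally show ?thesis by simp
    qed
    then show "\<forall>\<^sub>F n in sequentially. norm (exp (- real n) * (pi * (1 + real n)\<^sup>2)) \<le> pi * (exp (-1/2)) ^ n * 16"
      by simp
  qed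
  show A0: "A \<ge> 0" unfolding A_def by (intro suminf_nonneg sm) auto
  fix k :: real and a :: complex assume k: "k > 0"
  have "ennreal (exp (- k * dist z a)) \<le> (\<Sum>n. ennreal (exp (- real n)) * indicator (ball a ((1 + real n) / k)) z)" for z
  proof -
    define n where "n = nat \<lfloor>k * dist z a\<rfloor>"
    have n: "real n \<le> k * dist z a" "k * dist z a < 1 + real n"
    proof -
      have "real n = of_int \<lfloor>k * dist z a\<rfloor>" unfolding n_def using k by simp
      then show "real n \<le> k * dist z a" "k * dist z a < 1 + real n"
        using floor_correct[of "k * dist z a"] by linarith+
    qed
    have "ennreal (exp (- k * dist z a)) \<le> ennreal (exp (- real n)) * indicator (ball a ((1 + real n) / k)) z"
      using n k by (auto simp: field_simps dist_commute intro!: ennreal_leI split: split_indicator)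
    also have "\<dots> \<le> (\<Sum>n. ennreal (exp (- real n)) * indicator (ball a ((1 + real n) / k)) z)"
    proof -
      define f where "f n = ennreal (exp (- real n)) * indicator (ball a ((1 + real n) / k)) z" for n
      have "f n \<le> (\<Sum>n. f n)" using sum_le_suminf[of f "{n}"] by simp
      then show ?thesis unfolding f_def .
    qed
    finally show ?thesis .
  qed
  then have "(\<integral>\<^sup>+z. ennreal (exp (- k * dist z a)) \<partial>lborel) \<le>
      (\<integral>\<^sup>+z. (\<Sum>n. ennreal (exp (- real n)) * indicator (ball a ((1 + real n) / k)) z) \<partial>lborel)"
    by (intro nn_integral_mono)
  also have "\<dots> = (\<Sum>n. (\<integral>\<^sup>+z. ennreal (exp (- real n)) * indicator (ball a ((1 + real n) / k)) z \<partial>lborel))"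
    by (intro nn_integral_suminf borel_measurable_times_ennreal borel_measurable_indicator) auto
  also have "\<dots> = (\<Sum>n. ennreal (exp (- real n) * (pi * (1 + real n)\<^sup>2) / k\<^sup>2))"
    using k by (intro suminf_cong, subst nn_integral_cmult_indicator)
      (auto simp: emeasure_ball unit_ball_vol_2 ennreal_mult'[symmetric] power_divide)
  also have "\<dots> = ennreal (A / k\<^sup>2)"
    unfolding A_def using sm
    by (subst suminf_ennreal2) (auto intro!: summable_divide simp: suminf_divide)
  finally show "(\<integral>\<^sup>+z. ennreal (exp (- k * dist z a)) \<partial>lborel) \<le> ennreal (A / k\<^sup>2)" .
qed

text \<open>The functions to be averaged are already q-th powers, so this is the L^1 case of the
  Schur test for every q: Tonelli, and a bound uniform in \<open>\<omega>\<close> for the integral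
  of \<open>bump c z \<omega>\<close> over \<open>z\<close>.\<close>

lemma nn_integral_bump_average_le:
  assumes c: "c > 0"
  obtains C where "C \<ge> 0"
    "\<And>b. b \<in> borel_measurable lborel \<Longrightarrow>
       (\<integral>\<^sup>+z. (\<integral>\<^sup>+\<omega>. b \<omega> * ennreal (bump c z \<omega>) \<partial>lborel) \<partial>lborel) \<le> ennreal C * (\<integral>\<^sup>+\<omega>. b \<omega> \<partial>lborel)"
proof -
  obtain C0 where C0: "C0 \<ge> 0" and ex:
    "\<And>k (a::complex). k > 0 \<Longrightarrow> (\<integral>\<^sup>+z. ennreal (exp (- k * dist z a)) \<partial>lborel) \<le> ennreal (C0 / k\<^sup>2)"
    using nn_integral_exp_norm by metis
  have bump: "(\<integral>\<^sup>+z. ennreal (bump c z \<omega>) \<partial>lborel) \<le> ennreal (8 * C0 / c\<^sup>2)" for \<omega>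
  proof -
    define k where "k = c * (1 + norm \<omega>) / 2"
    have k: "k > 0" unfolding k_def using c by (simp add: add_pos_nonneg)
    have "bump c z \<omega> \<le> (1 + norm \<omega>)\<^sup>2 * (exp (- k * dist z \<omega>) + exp (- k * dist z (0::complex)))" for z
    proof -
      \<comment> \<open>The kernel decays at rate 1 + |z|, but \<open>z\<close> is integrated while
        \<open>\<omega>\<close> is fixed. Either the rate is comparable to 1 + |\<omega>|, or
        \<open>z\<close> is so much smaller than \<open>\<omega>\<close> that the distance supplies
        the factor 1 + |\<omega>| and the decay is in |z| itself.\<close>
      have "k * dist z \<omega> \<le> c * (1 + norm z) * dist z \<omega> \<or> k * dist z (0::complex) \<le> c * (1 + norm z) * dist z \<omega>"
      proof (cases "1 + norm \<omega> \<le> 2 * (1 + norm z)")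
        case True
        then have "c * (1 + norm \<omega>) / 2 \<le> c * (1 + norm z)" using c by simp
        then show ?thesis unfolding k_def by (intro disjI1 mult_right_mono) auto
      next
        case False
        then have "(1 + norm \<omega>) / 2 \<le> dist z \<omega>"
          using norm_triangle_ineq2[of \<omega> z] by (simp add: dist_norm norm_minus_commute)
        then have "((1 + norm \<omega>) / 2) * norm z \<le> dist z \<omega> * (1 + norm z)" by (intro mult_mono) auto
        then have "c * (((1 + norm \<omega>) / 2) * norm z) \<le> c * (dist z \<omega> * (1 + norm z))"
          using c by (intro mult_left_mono) auto
        then show ?thesis unfolding k_def by (intro disjI2) (simp add: mult_ac)
      qed
      then have "exp (- c * (1 + norm z) * dist z \<omega>) \<le> exp (- k * dist z \<omega>) + exp (- k * dist z (0::complex))"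
      proof
        assume "k * dist z \<omega> \<le> c * (1 + norm z) * dist z \<omega>"
        then have "exp (- c * (1 + norm z) * dist z \<omega>) \<le> exp (- k * dist z \<omega>)" by simp
        then show ?thesis using exp_ge_zero[of "- k * dist z (0::complex)"] by linarith
      next
        assume "k * dist z (0::complex) \<le> c * (1 + norm z) * dist z \<omega>"
        then have "exp (- c * (1 + norm z) * dist z \<omega>) \<le> exp (- k * dist z (0::complex))" by simp
        then show ?thesis using exp_ge_zero[of "- k * dist z \<omega>"] by linarith
      qed
      then show ?thesis unfolding bump_def by (intro mult_left_mono) auto
    qed
    then have "(\<integral>\<^sup>+z. ennreal (bump c z \<omega>) \<partial>lborel) \<le>
      (\<integral>\<^sup>+z. ennreal ((1 + norm \<omega>)\<^sup>2) * (ennreal (exp (- k * dist z \<omega>)) + ennreal (exp (- k * dist z (0::complex)))) \<partial>lborel)"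
      by (intro nn_integral_mono)
        (simp add: ennreal_mult'[symmetric] ennreal_plus[symmetric] del: ennreal_plus)
    also have "\<dots> = ennreal ((1 + norm \<omega>)\<^sup>2) * ((\<integral>\<^sup>+z. ennreal (exp (- k * dist z \<omega>)) \<partial>lborel)
        + (\<integral>\<^sup>+z. ennreal (exp (- k * dist z (0::complex))) \<partial>lborel))"
      by (subst nn_integral_cmult) (auto intro!: nn_integral_add arg_cong[where f="(*) _"])
    also have "\<dots> \<le> ennreal ((1 + norm \<omega>)\<^sup>2) * (ennreal (C0 / k\<^sup>2) + ennreal (C0 / k\<^sup>2))"
      by (intro mult_left_mono add_mono ex k) simp
    also have "\<dots> = ennreal ((1 + norm \<omega>)\<^sup>2 * (C0 / k\<^sup>2 + C0 / k\<^sup>2))"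
      using C0 by (subst ennreal_mult') (simp_all add: ennreal_plus[symmetric] del: ennreal_plus)
    also have "(1 + norm \<omega>)\<^sup>2 * (C0 / k\<^sup>2 + C0 / k\<^sup>2) = 8 * C0 / c\<^sup>2"
    proof -
      have "1 + norm \<omega> \<noteq> 0" by (simp add: add_nonneg_eq_0_iff)
      then show ?thesis unfolding k_def power_mult_distrib power_divide using c by (simp add: divide_simps)
    qed
    finally show ?thesis .
  qed
  show ?thesis
  proof (rule that[of "8 * C0 / c\<^sup>2"])
    fix b :: "complex \<Rightarrow> ennreal" assume [measurable]: "b \<in> borel_measurable lborel"
    have "(\<integral>\<^sup>+z. (\<integral>\<^sup>+\<omega>. b \<omega> * ennreal (bump c z \<omega>) \<partial>lborel) \<partial>lborel)
       = (\<integral>\<^sup>+\<omega>. (\<integral>\<^sup>+z. b \<omega> * ennreal (bump c z \<omega>) \<partial>lborel) \<partial>lborel)"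
      by (intro lborel_pair.Fubini') measurable
    also have "\<dots> = (\<integral>\<^sup>+\<omega>. b \<omega> * (\<integral>\<^sup>+z. ennreal (bump c z \<omega>) \<partial>lborel) \<partial>lborel)"
      unfolding bump_def by (intro nn_integral_cong nn_integral_cmult) measurable
    also have "\<dots> \<le> (\<integral>\<^sup>+\<omega>. b \<omega> * ennreal (8 * C0 / c\<^sup>2) \<partial>lborel)"
      by (intro nn_integral_mono mult_left_mono bump) simp
    also have "\<dots> = ennreal (8 * C0 / c\<^sup>2) * (\<integral>\<^sup>+\<omega>. b \<omega> \<partial>lborel)"
      by (subst nn_integral_multc) (auto simp: mult.commute)
    finally show "(\<integral>\<^sup>+z. (\<integral>\<^sup>+\<omega>. b \<omega> * ennreal (bump c z \<omega>) \<partial>lborel) \<partial>lborel)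
      \<le> ennreal (8 * C0 / c\<^sup>2) * (\<integral>\<^sup>+\<omega>. b \<omega> \<partial>lborel)" .
  qed (use C0 c in auto)
qed

text \<open>Cauchy's estimate on the circle of radius 1 / (1 + |z|), where |\<zeta>|^2 exceeds |z|^2
  by at most 3. The maximum point is kept as a witness because averaging needs its distance from
  \<open>z\<close>.\<close>

lemma fw_deriv_le_fw:
  assumes \<alpha>: "\<alpha> > 0" and hol: "F holomorphic_on UNIV"
  obtains \<zeta> where "dist z \<zeta> = 1 / (1 + norm z)"
    "fw \<alpha> 1 (deriv F) z \<le> exp (3 * \<alpha> / 2) * fw \<alpha> 0 F \<zeta>"
proof -
  define r where "r = 1 / (1 + norm z)"
  have pos: "1 + norm z > 0" by (simp add: add_pos_nonneg)
  have r: "r > 0" "r \<le> 1" and rr: "r * (1 + norm z) = 1"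
    unfolding r_def using pos by (auto simp: divide_simps)
  note cont = holomorphic_on_imp_continuous_on[OF hol]
  have "\<exists>\<zeta>\<in>sphere z r. \<forall>y\<in>sphere z r. norm (F y) \<le> norm (F \<zeta>)"
    using r by (intro continuous_attains_sup continuous_intros continuous_on_subset[OF cont]) auto
  then obtain \<zeta> where \<zeta>: "dist z \<zeta> = r" and max: "\<And>y. dist z y = r \<Longrightarrow> norm (F y) \<le> norm (F \<zeta>)"
    by auto
  have "norm ((deriv ^^ 1) F z) \<le> fact 1 * norm (F \<zeta>) / r ^ 1"
    using hol cont r max by (intro Cauchy_inequality)
      (auto intro: holomorphic_on_subset continuous_on_subset simp: dist_norm)
  then have 1: "norm (deriv F z) / (1 + norm z) \<le> norm (F \<zeta>)"
    unfolding r_def using pos by (simp add: field_simps)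
  have "norm \<zeta> \<le> norm z + r" using \<zeta> norm_triangle_ineq2[of \<zeta> z]
    by (simp add: dist_norm norm_minus_commute)
  then have "(norm \<zeta>)\<^sup>2 \<le> (norm z + r)\<^sup>2" by (intro power_mono) auto
  also have "\<dots> = (norm z)\<^sup>2 + 2 * (r * norm z) + r * r" by (simp add: power2_eq_square algebra_simps)
  also have "\<dots> \<le> (norm z)\<^sup>2 + 3"
  proof -
    have "r * norm z \<le> 1" "r * r \<le> 1" using rr r mult_le_one[of r r] by (auto simp: algebra_simps)
    then show ?thesis by linarith
  qed
  finally have "exp (- (\<alpha> / 2) * (norm z)\<^sup>2) \<le> exp (3 * \<alpha> / 2 + - (\<alpha> / 2) * (norm \<zeta>)\<^sup>2)"
    using \<alpha> mult_left_mono[of "(norm \<zeta>)\<^sup>2" "(norm z)\<^sup>2 + 3" "\<alpha>/2"] by (simp add: field_simps)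
  with 1 have "fw \<alpha> 1 (deriv F) z \<le> norm (F \<zeta>) * exp (3 * \<alpha> / 2 + - (\<alpha> / 2) * (norm \<zeta>)\<^sup>2)"
    unfolding fw_def by (intro mult_mono) auto
  also have "\<dots> = exp (3 * \<alpha> / 2) * fw \<alpha> 0 F \<zeta>" unfolding fw_def exp_add by simp
  finally show ?thesis using \<zeta> that r_def by blast
qed

text \<open>The point supplied by Cauchy's estimate depends on \<open>z\<close> in no controlled
  way. The average centred at \<open>z\<close> bounds the value there, with a constant loss
  \<open>exp 2\<close>, and is measurable in \<open>z\<close>, so that the Schur test
  applies.\<close>

lemma nn_integral_fw_deriv_le:
  assumes q: "q > 0" and \<alpha>: "\<alpha> > 0"
  obtains C where "C \<ge> 0"
    "\<And>F. F holomorphic_on UNIV \<Longrightarrow> (\<integral>\<^sup>+z. ennreal (fw \<alpha> 1 (deriv F) z powr q) \<partial>lborel)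
       \<le> ennreal C * (\<integral>\<^sup>+z. ennreal (fw \<alpha> 0 F z powr q) \<partial>lborel)"
proof -
  obtain C0 where C0: "C0 \<ge> 0" and avg:
    "\<And>h z \<zeta>. h holomorphic_on UNIV \<Longrightarrow> ennreal (fw \<alpha> 0 h \<zeta> powr q) \<le>
       ennreal (C0 * exp (2 * 1 * (1 + norm z) * dist z \<zeta>)) *
       (\<integral>\<^sup>+\<omega>. ennreal (fw \<alpha> 0 h \<omega> powr q) * ennreal (bump 1 z \<omega>) \<partial>lborel)"
    using fw_powr_le_bump_average[OF q \<alpha> zero_less_one] by blast
  obtain C1 where C1: "C1 \<ge> 0" and schur:
    "\<And>b. b \<in> borel_measurable lborel \<Longrightarrow>
       (\<integral>\<^sup>+z. (\<integral>\<^sup>+\<omega>. b \<omega> * ennreal (bump 1 z \<omega>) \<partial>lborel) \<partial>lborel) \<le> ennreal C1 * (\<integral>\<^sup>+\<omega>. b \<omega> \<partial>lborel)"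
    using nn_integral_bump_average_le[OF zero_less_one] by blast
  define C2 where "C2 = exp (3 * \<alpha> / 2) powr q * (C0 * exp 2)"
  have C2: "C2 \<ge> 0" unfolding C2_def using C0 by simp
  show ?thesis
  proof (rule that[of "C2 * C1"])
    show "0 \<le> C2 * C1" using C1 C2 by simp
    fix F assume hol: "F holomorphic_on UNIV"
    let ?A = "\<lambda>z. \<integral>\<^sup>+\<omega>. ennreal (fw \<alpha> 0 F \<omega> powr q) * ennreal (bump 1 z \<omega>) \<partial>lborel"
    have m[measurable]: "(\<lambda>\<omega>. ennreal (fw \<alpha> 0 F \<omega> powr q)) \<in> borel_measurable lborel" using hol by measurable
    have mA: "?A \<in> borel_measurable lborel"
      by (intro lborel.borel_measurable_nn_integral) measurable
    have pw: "ennreal (fw \<alpha> 1 (deriv F) z powr q) \<le> ennreal C2 * ?A z" for z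
    proof -
      obtain \<zeta> where \<zeta>: "dist z \<zeta> = 1 / (1 + norm z)"
        and le: "fw \<alpha> 1 (deriv F) z \<le> exp (3 * \<alpha> / 2) * fw \<alpha> 0 F \<zeta>"
        using fw_deriv_le_fw[OF \<alpha> hol] by blast
      have e: "exp (2 * 1 * (1 + norm z) * dist z \<zeta>) = exp 2"
      proof -
        have "(1 + norm z) * dist z \<zeta> = 1" unfolding \<zeta> by (simp add: add_nonneg_eq_0_iff)
        then show ?thesis by (simp only: mult.assoc) simp
      qed
      have "fw \<alpha> 1 (deriv F) z powr q \<le> (exp (3 * \<alpha> / 2) * fw \<alpha> 0 F \<zeta>) powr q"
        using le q by (intro powr_mono2) auto
      then have "ennreal (fw \<alpha> 1 (deriv F) z powr q) \<le> ennreal (exp (3 * \<alpha> / 2) powr q) * ennreal (fw \<alpha> 0 F \<zeta> powr q)"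
        by (simp add: powr_mult ennreal_mult'[symmetric] ennreal_leI)
      also have "\<dots> \<le> ennreal (exp (3 * \<alpha> / 2) powr q) * (ennreal (C0 * exp 2) * ?A z)"
        using avg[OF hol, of \<zeta> z] unfolding e by (intro mult_left_mono) auto
      also have "\<dots> = ennreal C2 * ?A z"
        unfolding C2_def using C0 by (simp add: ennreal_mult' mult.assoc)
      finally show ?thesis .
    qed
    have "(\<integral>\<^sup>+z. ennreal (fw \<alpha> 1 (deriv F) z powr q) \<partial>lborel) \<le> (\<integral>\<^sup>+z. ennreal C2 * ?A z \<partial>lborel)"
      by (intro nn_integral_mono pw)
    also have "\<dots> = ennreal C2 * (\<integral>\<^sup>+z. ?A z \<partial>lborel)"
      using mA by (rule nn_integral_cmult)
    also have "\<dots> \<le> ennreal C2 * (ennreal C1 * (\<integral>\<^sup>+z. ennreal (fw \<alpha> 0 F z powr q) \<partial>lborel))"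
      by (intro mult_left_mono schur m) auto
    finally show "(\<integral>\<^sup>+z. ennreal (fw \<alpha> 1 (deriv F) z powr q) \<partial>lborel)
       \<le> ennreal (C2 * C1) * (\<integral>\<^sup>+z. ennreal (fw \<alpha> 0 F z powr q) \<partial>lborel)"
      using C1 C2 by (simp add: ennreal_mult' mult.assoc)
  qed
qed

text \<open>Decay at rate |z|^2 confines the integral over the segment from 0 to \<open>z\<close> to
  a final piece of length about 1 / |z|, which offsets the factor 1 + |z|; for small
  \<open>z\<close> the segment itself is short.\<close>

lemma norm_le_of_deriv_decay:
  assumes hol: "F holomorphic_on UNIV" and F0: "F 0 = 0" and \<beta>: "\<beta> > 0" and B: "B \<ge> 0"
    and bd: "\<And>s. 0 < s \<Longrightarrow> s < 1 \<Longrightarrow>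
      norm (deriv F (of_real s * z)) \<le> B * (1 + norm z) * exp (- \<beta> * (1 - s) * (norm z)\<^sup>2)"
  shows "norm (F z) \<le> B * (2 + 2 / \<beta>)"
proof (cases "z = 0")
  case True
  then show ?thesis using F0 B \<beta> by simp
next
  case False
  define n where "n = norm z"
  have n: "n > 0" using False by (simp add: n_def)
  \<comment> \<open>An explicit antiderivative of the bound on the speed of \<open>F\<close> along
    the segment.\<close>
  define \<psi> where "\<psi> s = B * (1 + n) / (\<beta> * n) * exp (- \<beta> * (1 - s) * n\<^sup>2)" for s
  have \<psi>': "(\<psi> has_real_derivative B * (1 + n) * exp (- \<beta> * (1 - s) * n\<^sup>2) * n) (at s)" for s
  proof -
    have "((\<lambda>s. exp (- \<beta> * (1 - s) * n\<^sup>2)) has_real_derivative exp (- \<beta> * (1 - s) * n\<^sup>2) * (\<beta> * n\<^sup>2)) (at s)"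
    proof -
      have "((\<lambda>s. - \<beta> * (1 - s) * n\<^sup>2) has_real_derivative \<beta> * n\<^sup>2) (at s)"
        by (auto intro!: derivative_eq_intros)
      then show ?thesis by (rule DERIV_fun_exp)
    qed
    from DERIV_cmult[OF this, of "B * (1 + n) / (\<beta> * n)"] show ?thesis
      unfolding \<psi>_def using n \<beta> by (simp add: power2_eq_square mult_ac)
  qed
  have "norm (F (of_real 1 * z) - F (of_real 0 * z)) \<le> \<psi> 1 - \<psi> 0"
  proof (rule differentiable_bound_general[where f="\<lambda>s. F (of_real s * z)" and f'="\<lambda>s. z * deriv F (of_real s * z)"
        and \<phi>'="\<lambda>s. B * (1 + n) * exp (- \<beta> * (1 - s) * n\<^sup>2) * n"])
    show "continuous_on {0..1} (\<lambda>s::real. F (of_real s * z))"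
      by (rule continuous_on_compose2[OF holomorphic_on_imp_continuous_on[OF hol]])
        (auto intro!: continuous_intros)
    show "continuous_on {0..1} \<psi>"
      by (rule DERIV_continuous_on) (rule has_field_derivative_at_within[OF \<psi>'])
    fix s :: real assume s: "0 < s" "s < 1"
    have "((\<lambda>s. of_real s * z) has_vector_derivative z) (at s)"
      by (auto intro!: derivative_eq_intros)
    moreover have "(F has_field_derivative deriv F (of_real s * z)) (at (of_real s * z))"
      by (rule holomorphic_derivI[OF hol]) auto
    ultimately show "((\<lambda>s. F (of_real s * z)) has_vector_derivative z * deriv F (of_real s * z)) (at s)"
      using field_vector_diff_chain_at[of "\<lambda>s. of_real s * z" z s F] by (simp add: o_def)
    show "(\<psi> has_vector_derivative B * (1 + n) * exp (- \<beta> * (1 - s) * n\<^sup>2) * n) (at s)"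
      using \<psi>' by (simp add: has_real_derivative_iff_has_vector_derivative)
    show "norm (z * deriv F (of_real s * z)) \<le> B * (1 + n) * exp (- \<beta> * (1 - s) * n\<^sup>2) * n"
      using mult_right_mono[OF bd[OF s], of n] n by (simp add: norm_mult n_def mult_ac)
  qed simp
  then have "norm (F z) \<le> B * ((1 + n) / (\<beta> * n) * (1 - exp (- \<beta> * n\<^sup>2)))"
    using F0 by (simp add: \<psi>_def algebra_simps)
  also have "\<dots> \<le> B * (2 + 2 / \<beta>)"
  proof (intro mult_left_mono B)
    show "(1 + n) / (\<beta> * n) * (1 - exp (- \<beta> * n\<^sup>2)) \<le> 2 + 2 / \<beta>"
    \<comment> \<open>The quotient (1 + n) / n is at most 2 for \<open>n \<ge> 1\<close> but
      singular at 0, where 1 - exp (- x) \<le> x cancels the singularity.\<close>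
    proof (cases "n \<ge> 1")
      case True
      have "(1 + n) / (\<beta> * n) * (1 - exp (- \<beta> * n\<^sup>2)) \<le> (2 / \<beta>) * 1"
        using True \<beta> n by (intro mult_mono) (auto simp: divide_simps)
      then show ?thesis by simp
    next
      case False
      have "(1 + n) / (\<beta> * n) * (1 - exp (- \<beta> * n\<^sup>2)) \<le> (1 + n) / (\<beta> * n) * (\<beta> * n\<^sup>2)"
        using exp_ge_add_one_self[of "- \<beta> * n\<^sup>2"] \<beta> n by (intro mult_left_mono) auto
      also have "\<dots> = (1 + n) * n" using \<beta> n by (simp add: power2_eq_square)
      also have "\<dots> \<le> 2 * 1" using False n by (intro mult_mono) auto
      also have "\<dots> \<le> 2 + 2 / \<beta>" using \<beta> by simp
      finally show ?thesis .
    qed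
  qed
  finally show ?thesis .
qed

text \<open>Relative to its value at the end point the inverse Gaussian at s z is at most exp (-
  (\<alpha> / 2) (1 - s) |z|^2), so the weighted derivative may grow towards 0 at any rate
  \<open>\<gamma>\<close> below \<alpha> / 2. The rates that occur are 0, for a bounded symbol, and
  \<alpha> / 4, for finite q.\<close>

lemma fw_le_of_fw_deriv:
  assumes hol: "F holomorphic_on UNIV" and F0: "F 0 = 0" and \<gamma>: "\<gamma> < \<alpha> / 2" and \<alpha>: "\<alpha> > 0" and B: "B \<ge> 0"
    and bd: "\<And>s. 0 < s \<Longrightarrow> s < 1 \<Longrightarrow>
      fw \<alpha> 1 (deriv F) (of_real s * z) \<le> B * exp (\<gamma> * (1 - s) * (norm z)\<^sup>2)"
  shows "fw \<alpha> 0 F z \<le> B * (2 + 2 / (\<alpha> / 2 - \<gamma>))"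
proof -
  define E where "E = exp (\<alpha> / 2 * (norm z)\<^sup>2)"
  have "norm (F z) \<le> (B * E) * (2 + 2 / (\<alpha> / 2 - \<gamma>))"
  proof (rule norm_le_of_deriv_decay[OF hol F0])
    fix s :: real assume s: "0 < s" "s < 1"
    let ?w = "of_real s * z"
    have pos: "1 + norm ?w > 0" by (simp add: add_pos_nonneg)
    have nw: "norm ?w = s * norm z" using s by (simp add: norm_mult)
    have "s * norm z \<le> 1 * norm z" using s by (intro mult_right_mono) auto
    then have w1: "1 + norm ?w \<le> 1 + norm z" using nw by simp
    have "norm (deriv F ?w) = fw \<alpha> 1 (deriv F) ?w * ((1 + norm ?w) * exp (\<alpha> / 2 * (norm ?w)\<^sup>2))"
    proof -
      have "exp (- (\<alpha> / 2) * (norm ?w)\<^sup>2) * exp (\<alpha> / 2 * (norm ?w)\<^sup>2) = 1"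
        unfolding exp_add[symmetric] by simp
      moreover have "fw \<alpha> 1 (deriv F) ?w * ((1 + norm ?w) * exp (\<alpha> / 2 * (norm ?w)\<^sup>2))
        = norm (deriv F ?w) * ((1 + norm ?w) / (1 + norm ?w))
          * (exp (- (\<alpha> / 2) * (norm ?w)\<^sup>2) * exp (\<alpha> / 2 * (norm ?w)\<^sup>2))"
        unfolding fw_def by simp
      ultimately show ?thesis using pos by simp
    qed
    also have "\<dots> \<le> (B * exp (\<gamma> * (1 - s) * (norm z)\<^sup>2)) * ((1 + norm z) * exp (\<alpha> / 2 * (norm ?w)\<^sup>2))"
      using w1 B by (intro mult_mono bd s) auto
    also have "\<dots> = B * (1 + norm z) * exp (\<gamma> * (1 - s) * (norm z)\<^sup>2 + \<alpha> / 2 * (norm ?w)\<^sup>2)"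
      unfolding exp_add by simp
    also have "\<dots> \<le> B * (1 + norm z) * exp (\<alpha> / 2 * (norm z)\<^sup>2 + - (\<alpha> / 2 - \<gamma>) * (1 - s) * (norm z)\<^sup>2)"
    proof -
      \<comment> \<open>Replaces the exact exponent with 1 - s^2 by one with 1 - s, whose
        exponential has an elementary antiderivative.\<close>
      have "s * s \<le> s" using s by (simp add: mult_left_le)
      then have "\<alpha> / 2 * (s\<^sup>2 * (norm z)\<^sup>2) \<le> \<alpha> / 2 * (s * (norm z)\<^sup>2)"
        using \<alpha> by (intro mult_left_mono mult_right_mono) (auto simp: power2_eq_square)
      then have "\<gamma> * (1 - s) * (norm z)\<^sup>2 + \<alpha> / 2 * (norm ?w)\<^sup>2
          \<le> \<alpha> / 2 * (norm z)\<^sup>2 + - (\<alpha> / 2 - \<gamma>) * (1 - s) * (norm z)\<^sup>2"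
        unfolding nw power_mult_distrib by (simp add: field_simps)
      then show ?thesis using B by (intro mult_left_mono) auto
    qed
    also have "\<dots> = B * E * (1 + norm z) * exp (- (\<alpha> / 2 - \<gamma>) * (1 - s) * (norm z)\<^sup>2)"
      unfolding exp_add E_def by simp
    finally show "norm (deriv F ?w) \<le> B * E * (1 + norm z) * exp (- (\<alpha> / 2 - \<gamma>) * (1 - s) * (norm z)\<^sup>2)" .
  qed (use \<gamma> B in \<open>auto simp: E_def\<close>)
  then have "norm (F z) * (1 / E) \<le> (B * E) * (2 + 2 / (\<alpha> / 2 - \<gamma>)) * (1 / E)"
    by (intro mult_right_mono) (auto simp: E_def)
  also have "\<dots> = B * (2 + 2 / (\<alpha> / 2 - \<gamma>)) * (E * (1 / E))" by (simp only: mult_ac)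
  also have "E * (1 / E) = 1" by (simp add: E_def)
  finally have *: "norm (F z) * (1 / E) \<le> B * (2 + 2 / (\<alpha> / 2 - \<gamma>))" by (simp only: mult_1_right)
  have "exp (- (\<alpha> / 2) * (norm z)\<^sup>2) = 1 / E"
    unfolding E_def by (simp only: exp_minus inverse_eq_divide minus_mult_left[symmetric])
  then have "fw \<alpha> 0 F z = norm (F z) * (1 / E)" unfolding fw_def by (simp only: power_0 div_by_1)
  with * show ?thesis by (simp only:)
qed

text \<open>The average is centred at the end point of the segment. Its q-th root becomes the
  constant in a pointwise bound for \<open>F\<close>, and its growth towards 0 stays below the
  admissible rate.\<close>

lemma nn_integral_fw_le:
  assumes q: "q > 0" and \<alpha>: "\<alpha> > 0"
  obtains C where "C \<ge> 0"
    "\<And>F. F holomorphic_on UNIV \<Longrightarrow> F 0 = 0 \<Longrightarrow> (\<integral>\<^sup>+z. ennreal (fw \<alpha> 0 F z powr q) \<partial>lborel)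
       \<le> ennreal C * (\<integral>\<^sup>+z. ennreal (fw \<alpha> 1 (deriv F) z powr q) \<partial>lborel)"
proof -
  \<comment> \<open>The q-th root turns the exponent 2 c into 2 c / q = \<alpha> / 8. Since (1 +
    |z|) (1 - s) |z| is at most 2 (1 - s) |z|^2 + 1, the resulting rate is \<alpha> / 4, half of the
    admissible \<alpha> / 2.\<close>
  define c where "c = \<alpha> * q / 16"
  have c: "c > 0" unfolding c_def using q \<alpha> by simp
  obtain C where C: "C \<ge> 0" and avg:
    "\<And>h z \<zeta>. h holomorphic_on UNIV \<Longrightarrow> ennreal (fw \<alpha> 1 h \<zeta> powr q) \<le>
       ennreal (C * exp (2 * c * (1 + norm z) * dist z \<zeta>)) *
       (\<integral>\<^sup>+\<omega>. ennreal (fw \<alpha> 1 h \<omega> powr q) * ennreal (bump c z \<omega>) \<partial>lborel)"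
    using fw_powr_le_bump_average[OF q \<alpha> c] by blast
  \<comment> \<open>Strictly positive, so that \<open>C2\<close> times an infinite average is
    infinite and the pointwise bound is trivial in that case.\<close>
  define C0 where "C0 = C + 1"
  have C0: "C0 > 0" "C \<le> C0" unfolding C0_def using C by auto
  obtain C1 where C1: "C1 \<ge> 0" and schur:
    "\<And>b. b \<in> borel_measurable lborel \<Longrightarrow>
       (\<integral>\<^sup>+z. (\<integral>\<^sup>+\<omega>. b \<omega> * ennreal (bump c z \<omega>) \<partial>lborel) \<partial>lborel) \<le> ennreal C1 * (\<integral>\<^sup>+\<omega>. b \<omega> \<partial>lborel)"
    using nn_integral_bump_average_le[OF c] by blast
  define C2 where "C2 = C0 * (exp (\<alpha> / 8) * (2 + 8 / \<alpha>)) powr q"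
  have C2: "C2 > 0" unfolding C2_def
  proof -
    have "2 + 8 / \<alpha> > 0" using \<alpha> by (simp add: add_pos_pos)
    then have "(exp (\<alpha> / 8) * (2 + 8 / \<alpha>)) powr q > 0" by simp
    then show "C0 * (exp (\<alpha> / 8) * (2 + 8 / \<alpha>)) powr q > 0" using C0 by simp
  qed
  show ?thesis
  proof (rule that[of "C2 * C1"])
    show "0 \<le> C2 * C1" using C1 C2 by simp
    fix F assume hol: "F holomorphic_on UNIV" and F0: "F 0 = 0"
    have hol': "deriv F holomorphic_on UNIV" using hol by (rule holomorphic_deriv) simp
    let ?A = "\<lambda>z. \<integral>\<^sup>+\<omega>. ennreal (fw \<alpha> 1 (deriv F) \<omega> powr q) * ennreal (bump c z \<omega>) \<partial>lborel"
    have m[measurable]: "(\<lambda>\<omega>. ennreal (fw \<alpha> 1 (deriv F) \<omega> powr q)) \<in> borel_measurable lborel"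
      using hol' by measurable
    have mA: "?A \<in> borel_measurable lborel"
      by (intro lborel.borel_measurable_nn_integral) measurable
    have pw: "ennreal (fw \<alpha> 0 F z powr q) \<le> ennreal C2 * ?A z" for z
    proof (cases "?A z")
      case top
      then show ?thesis using C2 by (simp add: ennreal_mult_top)
    next
      case (real a)
      \<comment> \<open>\<open>exp (\<alpha> / 8)\<close> takes up the additive constant in the
        exponent and leaves a pure multiple of (1 - s) |z|^2.\<close>
      define B where "B = (C0 * a) powr (1/q) * exp (\<alpha> / 8)"
      have "fw \<alpha> 0 F z \<le> B * (2 + 2 / (\<alpha> / 2 - \<alpha> / 4))"
      proof (rule fw_le_of_fw_deriv[OF hol F0])
        fix s :: real assume s: "0 < s" "s < 1"
        let ?w = "of_real s * z"
        have "z - ?w = of_real (1 - s) * z" by (simp add: algebra_simps)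
        then have d: "dist z ?w = (1 - s) * norm z" using s by (simp only: dist_norm norm_mult norm_of_real)
        have "ennreal (fw \<alpha> 1 (deriv F) ?w powr q) \<le> ennreal (C * exp (2 * c * (1 + norm z) * dist z ?w)) * ennreal a"
          using avg[OF hol', of ?w z] real by simp
        then have "fw \<alpha> 1 (deriv F) ?w powr q \<le> C * exp (2 * c * (1 + norm z) * dist z ?w) * a"
          using C real by (simp add: ennreal_mult'[symmetric])
        also have "\<dots> \<le> C0 * exp (2 * c * (1 + norm z) * dist z ?w) * a"
          using C0 real by (intro mult_right_mono) auto
        finally have "(fw \<alpha> 1 (deriv F) ?w powr q) powr (1/q)
            \<le> (C0 * exp (2 * c * (1 + norm z) * dist z ?w) * a) powr (1/q)"
          using q by (intro powr_mono2) auto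
        then have "fw \<alpha> 1 (deriv F) ?w \<le> (C0 * a * exp (2 * c * (1 + norm z) * dist z ?w)) powr (1/q)"
          using q by (simp add: powr_powr mult_ac)
        also have "\<dots> = (C0 * a) powr (1/q) * exp (2 * c / q * ((1 + norm z) * dist z ?w))"
          using C0 real by (simp add: powr_mult exp_powr_real mult_ac)
        also have "\<dots> \<le> (C0 * a) powr (1/q) * exp (\<alpha> / 8 + \<alpha> / 4 * (1 - s) * (norm z)\<^sup>2)"
        proof -
          have e: "2 * c / q = \<alpha> / 8" unfolding c_def using q by simp
          have "(1 - s) * norm z \<le> (1 - s) * (norm z)\<^sup>2 + 1"
          proof (cases "norm z \<ge> 1")
            case True
            then have "norm z * 1 \<le> norm z * norm z" by (intro mult_left_mono) auto
            then have "(1 - s) * norm z \<le> (1 - s) * (norm z)\<^sup>2"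
              using s by (intro mult_left_mono) (auto simp: power2_eq_square)
            then show ?thesis by simp
          next
            case False
            then have "(1 - s) * norm z \<le> 1" using s by (intro mult_le_one) auto
            moreover have "(1 - s) * (norm z)\<^sup>2 \<ge> 0" using s by simp
            ultimately show ?thesis by linarith
          qed
          then have "(1 + norm z) * dist z ?w \<le> 2 * ((1 - s) * (norm z)\<^sup>2) + 1"
            unfolding d by (simp add: algebra_simps power2_eq_square)
          then have "2 * c / q * ((1 + norm z) * dist z ?w) \<le> \<alpha> / 8 * (2 * ((1 - s) * (norm z)\<^sup>2) + 1)"
            unfolding e using \<alpha> by (intro mult_left_mono) auto
          also have "\<dots> = \<alpha> / 8 + \<alpha> / 4 * (1 - s) * (norm z)\<^sup>2" by (simp add: field_simps)
          finally show ?thesis by (intro mult_left_mono) auto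
        qed
        also have "\<dots> = B * exp (\<alpha> / 4 * (1 - s) * (norm z)\<^sup>2)" unfolding B_def exp_add by simp
        finally show "fw \<alpha> 1 (deriv F) ?w \<le> B * exp (\<alpha> / 4 * (1 - s) * (norm z)\<^sup>2)" .
      qed (use \<alpha> in \<open>auto simp: B_def\<close>)
      also have "2 + 2 / (\<alpha> / 2 - \<alpha> / 4) = 2 + 8 / \<alpha>" using \<alpha> by (simp add: field_simps)
      finally have "fw \<alpha> 0 F z powr q \<le> (B * (2 + 8 / \<alpha>)) powr q" using q by (intro powr_mono2) auto
      also have "B * (2 + 8 / \<alpha>) = (C0 * a) powr (1/q) * (exp (\<alpha> / 8) * (2 + 8 / \<alpha>))"
        unfolding B_def by simp
      also have "\<dots> powr q = C2 * a"
        unfolding C2_def using C0 real q \<alpha> by (simp add: powr_mult powr_powr)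
      finally show ?thesis using real C2 by (simp add: ennreal_mult'[symmetric] ennreal_leI)
    qed
    have "(\<integral>\<^sup>+z. ennreal (fw \<alpha> 0 F z powr q) \<partial>lborel) \<le> (\<integral>\<^sup>+z. ennreal C2 * ?A z \<partial>lborel)"
      by (intro nn_integral_mono pw)
    also have "\<dots> = ennreal C2 * (\<integral>\<^sup>+z. ?A z \<partial>lborel)"
      using mA by (rule nn_integral_cmult)
    also have "\<dots> \<le> ennreal C2 * (ennreal C1 * (\<integral>\<^sup>+z. ennreal (fw \<alpha> 1 (deriv F) z powr q) \<partial>lborel))"
      by (intro mult_left_mono schur m) auto
    finally show "(\<integral>\<^sup>+z. ennreal (fw \<alpha> 0 F z powr q) \<partial>lborel)
       \<le> ennreal (C2 * C1) * (\<integral>\<^sup>+z. ennreal (fw \<alpha> 1 (deriv F) z powr q) \<partial>lborel)"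
      using C1 C2 by (simp add: ennreal_mult' mult.assoc)
  qed
qed

section \<open>Test functions\<close>

text \<open>
  In modulus, and relative to the Fock weight, \<open>strip_term \<alpha> y\<close> is \<open>exp (- \<alpha> (Im z - y)\<^sup>2)\<close>: it lives on
  the horizontal strip at height \<open>y\<close>. A sum over an arithmetic progression of large difference \<open>N\<close> is
  dominated by one term on each such strip; the \<open>N\<close> residue classes together cover the upper half plane.
\<close>

definition strip_term :: "real \<Rightarrow> real \<Rightarrow> complex \<Rightarrow> complex" where
  "strip_term \<alpha> y z = exp (of_real (\<alpha> / 2) * (z - 2 * \<i> * of_real y)\<^sup>2 + of_real (\<alpha> * y\<^sup>2))"

definition strip_sum :: "real \<Rightarrow> nat \<Rightarrow> nat \<Rightarrow> complex \<Rightarrow> complex" where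
  "strip_sum \<alpha> N s z = (\<Sum>k. strip_term \<alpha> (real (s + N * k)) z)"

text \<open>Completing the square. The constant term \<open>\<alpha> * y\<^sup>2\<close> in the
  exponent makes the peak of the weighted modulus equal to 1, whatever \<open>y\<close>.\<close>

lemma norm_strip_term:
  "norm (strip_term \<alpha> y z) = exp (\<alpha> / 2 * (norm z)\<^sup>2) * exp (- \<alpha> * (Im z - y)\<^sup>2)"
proof -
  have "Re (of_real (\<alpha> / 2) * (z - 2 * \<i> * of_real y)\<^sup>2 + of_real (\<alpha> * y\<^sup>2))
      = \<alpha> / 2 * (norm z)\<^sup>2 + - \<alpha> * (Im z - y)\<^sup>2"
    unfolding cmod_power2 by (simp add: power2_eq_square field_simps)
  then show ?thesis unfolding strip_term_def norm_exp_eq_Re by (simp only: exp_add)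
qed

lemma strip_term_has_derivative:
  "(strip_term \<alpha> y has_field_derivative of_real \<alpha> * (z - 2 * \<i> * of_real y) * strip_term \<alpha> y z) (at z within S)"
  unfolding strip_term_def by (auto intro!: derivative_eq_intros)

text \<open>On the line Im z = y the point z - 2 i y is the conjugate of z, so its modulus is |z|.
  Near that line the linear factor produced by differentiation is thus of the size of |z|, uniformly
  in \<open>y\<close>, as the division by 1 + |z| requires.\<close>

lemma norm_minus_two_imaginary_le: "norm (z - 2 * \<i> * of_real y) \<le> norm z + 2 * \<bar>Im z - y\<bar>"
proof -
  have e: "norm (of_real (2 * (Im z - y)) * \<i>) = 2 * \<bar>Im z - y\<bar>"
    by (simp only: norm_mult norm_of_real norm_ii abs_mult)
  have "z - 2 * \<i> * of_real y = cnj z + of_real (2 * (Im z - y)) * \<i>"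
    by (simp add: complex_eq_iff)
  also have "norm \<dots> \<le> norm (cnj z) + norm (of_real (2 * (Im z - y)) * \<i>)" by (rule norm_triangle_ineq)
  also have "\<dots> = norm z + 2 * \<bar>Im z - y\<bar>" unfolding e by simp
  finally show ?thesis .
qed

lemma norm_minus_two_imaginary_ge: "norm z - 2 * \<bar>Im z - y\<bar> \<le> norm (z - 2 * \<i> * of_real y)"
proof -
  have e: "norm (of_real (2 * (Im z - y)) * \<i>) = 2 * \<bar>Im z - y\<bar>"
    by (simp only: norm_mult norm_of_real norm_ii abs_mult)
  have "cnj z = (z - 2 * \<i> * of_real y) - of_real (2 * (Im z - y)) * \<i>"
    by (simp add: complex_eq_iff)
  then have "norm (cnj z) \<le> norm (z - 2 * \<i> * of_real y) + norm (of_real (2 * (Im z - y)) * \<i>)"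
    using norm_triangle_ineq4 by metis
  then show ?thesis unfolding e by simp
qed

text \<open>Lets a part of the Gaussian decay pay for the linear factor that differentiation
  produces.\<close>

lemma linear_le_exp_square:
  fixes t a :: real assumes a: "a > 0"
  shows "1 + 2 * t \<le> exp (1 / a) * exp (a * t\<^sup>2)"
proof -
  have "0 \<le> (a * t - 1)\<^sup>2 / a" using a by simp
  also have "\<dots> = a * t\<^sup>2 - 2 * t + 1 / a" using a by (simp add: power2_eq_square field_simps)
  finally have "2 * t \<le> 1 / a + a * t\<^sup>2" by simp
  moreover have "1 + 2 * t \<le> exp (2 * t)" by (rule exp_ge_add_one_self)
  ultimately show ?thesis unfolding exp_add[symmetric] by (meson exp_le_cancel_iff order_trans)
qed

text \<open>Termwise differentiation by the Weierstrass test on a disc about 0 with \<open>z\<close>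
  in its interior. There (Im x - y)^2 \<ge> y^2 / 2 - (Im x)^2 gives a decay in y that is uniform in
  x.\<close>

lemma strip_sum_has_derivative:
  assumes \<alpha>: "\<alpha> > 0" and N: "N > 0"
  shows "(strip_sum \<alpha> N s has_field_derivative
    (\<Sum>k. of_real \<alpha> * (z - 2 * \<i> * of_real (real (s + N * k))) * strip_term \<alpha> (real (s + N * k)) z)) (at z)"
proof -
  define R where "R = norm z + 1"
  define y where "y k = real (s + N * k)" for k
  have R: "R \<ge> 1" by (simp add: R_def)
  define K where "K = exp (\<alpha> / 2 * R\<^sup>2) * exp (\<alpha> * R\<^sup>2)"
  have K: "K > 0" by (simp add: K_def)
  have bound: "norm (strip_term \<alpha> (y k) x) \<le> K * exp (- \<alpha> / 2 * (y k)\<^sup>2)" if "norm x \<le> R" for x k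
  proof -
    have "0 \<le> (2 * Im x - y k)\<^sup>2" by simp
    then have "(y k)\<^sup>2 / 2 \<le> (Im x - y k)\<^sup>2 + (Im x)\<^sup>2" by (simp add: power2_eq_square algebra_simps)
    moreover have "\<bar>Im x\<bar> \<le> \<bar>R\<bar>" using that abs_Im_le_cmod[of x] by simp
    then have "(Im x)\<^sup>2 \<le> R\<^sup>2" by (simp add: abs_le_square_iff)
    ultimately have "\<alpha> * ((y k)\<^sup>2 / 2) \<le> \<alpha> * ((Im x - y k)\<^sup>2 + R\<^sup>2)"
      using \<alpha> by (intro mult_left_mono) auto
    then have "- \<alpha> * (Im x - y k)\<^sup>2 \<le> \<alpha> * R\<^sup>2 + - \<alpha> / 2 * (y k)\<^sup>2" by (simp add: algebra_simps)
    moreover have "\<alpha> / 2 * (norm x)\<^sup>2 \<le> \<alpha> / 2 * R\<^sup>2" using that \<alpha> by (intro mult_left_mono power_mono) auto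
    ultimately have "\<alpha> / 2 * (norm x)\<^sup>2 + - \<alpha> * (Im x - y k)\<^sup>2 \<le> \<alpha> / 2 * R\<^sup>2 + \<alpha> * R\<^sup>2 + - \<alpha> / 2 * (y k)\<^sup>2"
      by linarith
    then have "exp (\<alpha> / 2 * (norm x)\<^sup>2 + - \<alpha> * (Im x - y k)\<^sup>2)
        \<le> exp (\<alpha> / 2 * R\<^sup>2 + \<alpha> * R\<^sup>2 + - \<alpha> / 2 * (y k)\<^sup>2)"
      by (simp only: exp_le_cancel_iff)
    then show ?thesis unfolding norm_strip_term K_def exp_add .
  qed
  \<comment> \<open>A natural number is at most its square, so Gaussian decay in \<open>y k\<close>
    is at least geometric in \<open>k\<close>.\<close>
  have yk: "real k \<le> (y k)\<^sup>2" for k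
  proof -
    have "k \<le> s + N * k" using N by (simp add: trans_le_add2)
    moreover have "s + N * k \<le> (s + N * k)\<^sup>2" using le_square[of "s + N * k"] by (simp only: power2_eq_square)
    ultimately have "k \<le> (s + N * k)\<^sup>2" by linarith
    then show ?thesis unfolding y_def by (metis of_nat_le_iff of_nat_power)
  qed
  \<comment> \<open>Of the decay rate \<alpha> / 2, one half is spent on the linear factor and the
    other half yields the geometric majorant.\<close>
  define D where "D = \<alpha> * (R * exp (4 / \<alpha>))"
  have D: "D \<ge> 0" using \<alpha> R by (simp add: D_def)
  define M where "M k = D * K * exp (- \<alpha> / 4) ^ k" for k :: nat
  have "norm (exp (- \<alpha> / 4)) < 1" using \<alpha> by simp
  then have smM: "summable M" unfolding M_def by (intro summable_mult summable_geometric)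
  have expk: "exp (\<alpha> / 4 * (y k)\<^sup>2) * exp (- \<alpha> / 2 * (y k)\<^sup>2) \<le> exp (- \<alpha> / 4) ^ k" for k
  proof -
    have "\<alpha> / 4 * (y k)\<^sup>2 + - \<alpha> / 2 * (y k)\<^sup>2 \<le> real k * (- \<alpha> / 4)"
      using mult_left_mono[OF yk[of k], of "\<alpha> / 4"] \<alpha> by (simp add: algebra_simps)
    then show ?thesis unfolding exp_add[symmetric] exp_of_nat_mult[symmetric] by simp
  qed
  have derb: "norm (of_real \<alpha> * (x - 2 * \<i> * of_real (y k)) * strip_term \<alpha> (y k) x) \<le> M k"
    if x: "norm x \<le> R" for x k
  proof -
    have "norm (x - 2 * \<i> * of_real (y k)) \<le> norm x + norm (2 * \<i> * of_real (y k))"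
      by (rule norm_triangle_ineq4)
    also have "\<dots> \<le> R + 2 * y k" using x by (simp only: norm_mult norm_of_real norm_ii) (simp add: y_def)
    also have "\<dots> \<le> R * (1 + 2 * y k)"
    proof -
      have "1 * (2 * y k) \<le> R * (2 * y k)" using R by (intro mult_right_mono) (auto simp: y_def)
      then show ?thesis by (simp add: algebra_simps)
    qed
    also have "\<dots> \<le> R * (exp (4 / \<alpha>) * exp (\<alpha> / 4 * (y k)\<^sup>2))"
      using linear_le_exp_square[of "\<alpha>/4" "y k"] \<alpha> R by (intro mult_left_mono) auto
    finally have "norm (x - 2 * \<i> * of_real (y k)) \<le> R * (exp (4 / \<alpha>) * exp (\<alpha> / 4 * (y k)\<^sup>2))" .
    then have "\<alpha> * norm (x - 2 * \<i> * of_real (y k)) * norm (strip_term \<alpha> (y k) x)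
      \<le> \<alpha> * (R * (exp (4 / \<alpha>) * exp (\<alpha> / 4 * (y k)\<^sup>2))) * (K * exp (- \<alpha> / 2 * (y k)\<^sup>2))"
      using \<alpha> R K by (intro mult_mono bound x) auto
    also have "\<dots> = D * K * (exp (\<alpha> / 4 * (y k)\<^sup>2) * exp (- \<alpha> / 2 * (y k)\<^sup>2))" by (simp add: D_def)
    also have "\<dots> \<le> M k" unfolding M_def using D K by (intro mult_left_mono expk) auto
    finally show ?thesis using \<alpha> by (simp add: norm_mult)
  qed
  have "summable (\<lambda>k. strip_term \<alpha> (y k) z)"
  proof (rule summable_comparison_test')
    show "summable (\<lambda>k. K * exp (- \<alpha> / 4) ^ k)"
      using \<open>norm (exp (- \<alpha> / 4)) < 1\<close> by (intro summable_mult summable_geometric)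
    show "norm (strip_term \<alpha> (y k) z) \<le> K * exp (- \<alpha> / 4) ^ k" for k
    proof -
      have "norm (strip_term \<alpha> (y k) z) \<le> K * exp (- \<alpha> / 2 * (y k)\<^sup>2)" by (rule bound) (simp add: R_def)
      also have "\<dots> \<le> K * (exp (\<alpha> / 4 * (y k)\<^sup>2) * exp (- \<alpha> / 2 * (y k)\<^sup>2))"
      proof -
        have "1 \<le> exp (\<alpha> / 4 * (y k)\<^sup>2)" using \<alpha> by simp
        from mult_right_mono[OF this, of "exp (- \<alpha> / 2 * (y k)\<^sup>2)"] show ?thesis
          using K by (intro mult_left_mono) auto
      qed
      also have "\<dots> \<le> K * exp (- \<alpha> / 4) ^ k" using K by (intro mult_left_mono expk) auto
      finally show ?thesis .
    qed
  qed
  then have "((\<lambda>x. \<Sum>k. strip_term \<alpha> (y k) x) has_field_derivative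
      (\<Sum>k. of_real \<alpha> * (z - 2 * \<i> * of_real (y k)) * strip_term \<alpha> (y k) z)) (at z)"
  proof (intro has_field_derivative_series'(2)[where S="cball 0 R" and x0=z])
    show "uniformly_convergent_on (cball 0 R)
      (\<lambda>n x. \<Sum>i<n. of_real \<alpha> * (x - 2 * \<i> * of_real (y i)) * strip_term \<alpha> (y i) x)"
      using derb smM by (intro Weierstrass_m_test') auto
    show "z \<in> interior (cball 0 R)" by (simp add: R_def)
  qed (auto intro: strip_term_has_derivative simp: R_def)
  then show ?thesis unfolding y_def strip_sum_def[abs_def] .
qed

text \<open>The \<open>n\<close>-th term is isolated and the others are compared with a two-sided
  geometric series, each side contributing at most X / (1 - X). With truncated subtraction (k - n) +
  (n - k) is the distance of \<open>k\<close> from \<open>n\<close>.\<close>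

lemma suminf_geometric_tail:
  fixes a :: "nat \<Rightarrow> complex"
  assumes X: "0 \<le> X" "X < 1" and D: "D \<ge> 0"
    and a: "\<And>k. k \<noteq> n \<Longrightarrow> norm (a k) \<le> D * X ^ ((k - n) + (n - k))"
  shows "norm (suminf a - a n) \<le> D * (2 * X / (1 - X))"
proof -
  define b where "b k = (if k = n then 0 else a k)" for k
  define d where "d k = (if k = n then 0 else X ^ ((k - n) + (n - k)))" for k
  have "(\<lambda>j. X ^ j) sums (1 / (1 - X))" using X by (intro geometric_sums) auto
  then have "(\<lambda>j. X * X ^ j) sums (X * (1 / (1 - X)))" by (rule sums_mult)
  then have tail: "(\<lambda>j. d (j + Suc n)) sums (X / (1 - X))"
    by (simp add: d_def Suc_diff_le)
  then have sd: "summable d" using summable_iff_shift sums_summable by blast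
  have "(\<Sum>k<Suc n. d k) = (\<Sum>k<n. X ^ (n - k))" by (simp add: d_def)
  \<comment> \<open>Read backwards, the finite side is a partial sum of the series on the other
    side.\<close>
  also have "\<dots> = (\<Sum>k<n. X ^ Suc k)"
  proof -
    have "(\<Sum>k<n. X ^ (n - k)) = (\<Sum>k<n. X ^ Suc (n - Suc k))"
      by (intro sum.cong) (auto simp: Suc_diff_Suc simp del: power_Suc)
    also have "\<dots> = (\<Sum>k<n. X ^ Suc k)" by (rule sum.nat_diff_reindex)
    finally show ?thesis .
  qed
  also have "\<dots> \<le> (\<Sum>k. X ^ Suc k)"
    using X by (intro sum_le_suminf) (auto intro!: summable_mult)
  also have "\<dots> = X / (1 - X)" using tail by (simp add: d_def Suc_diff_le sums_iff)
  finally have head: "(\<Sum>k<Suc n. d k) \<le> X / (1 - X)" .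
  have "suminf d = (\<Sum>j. d (j + Suc n)) + (\<Sum>k<Suc n. d k)"
    using sd by (rule suminf_split_initial_segment)
  also have "\<dots> \<le> 2 * X / (1 - X)" using tail head by (simp add: sums_iff)
  finally have dle: "suminf d \<le> 2 * X / (1 - X)" .
  have nb: "norm (b k) \<le> D * d k" for k using a D by (simp add: b_def d_def)
  have sDd: "summable (\<lambda>k. D * d k)" using sd by (rule summable_mult)
  have sb: "summable b" by (rule summable_comparison_test'[OF sDd]) (rule nb)
  have "(\<lambda>k. b k + (if k = n then a n else 0)) sums (suminf b + a n)"
    using sb sums_If_finite_set[of "{n}" a] sums_single[of n a]
    by (intro sums_add summable_sums) (auto simp: if_distrib cong: if_cong)
  also have "(\<lambda>k. b k + (if k = n then a n else 0)) = a" by (auto simp: b_def)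
  finally have "suminf a - a n = suminf b" by (simp add: sums_iff)
  also have "norm \<dots> \<le> (\<Sum>k. D * d k)"
    by (rule norm_suminf_le[OF nb sDd])
  also have "\<dots> = D * suminf d" using sd by (rule suminf_mult)
  also have "\<dots> \<le> D * (2 * X / (1 - X))" using dle D by (rule mult_left_mono)
  finally show ?thesis .
qed

lemma strip_sum_holomorphic:
  assumes "\<alpha> > 0" and "N > 0"
  shows "strip_sum \<alpha> N s holomorphic_on UNIV"
  unfolding holomorphic_on_def field_differentiable_def
  using strip_sum_has_derivative[OF assms] has_field_derivative_at_within by blast

text \<open>Rounding leaves \<open>n\<close> within 1/2 of \<open>t\<close>, and this is at most
  half of the distance from \<open>n\<close> to any other integer; for negative \<open>t\<close> the
  choice is 0.\<close>

lemma nearest_nat: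
  fixes t :: real
  obtains n :: nat where "\<And>k::nat. \<bar>real k - real n\<bar> / 2 \<le> \<bar>t - real k\<bar>"
proof (cases "t \<ge> 0")
  case True
  define n where "n = nat \<lfloor>t + 1/2\<rfloor>"
  have "real n = of_int \<lfloor>t + 1/2\<rfloor>" using True by (simp add: n_def)
  then have n: "\<bar>t - real n\<bar> \<le> 1/2" using floor_correct[of "t + 1/2"] by linarith
  show ?thesis
  proof (rule that[of n])
    fix k :: nat
    show "\<bar>real k - real n\<bar> / 2 \<le> \<bar>t - real k\<bar>"
    proof (cases "k = n")
      case False
      then have "1 \<le> \<bar>real k - real n\<bar>" by linarith
      with n show ?thesis by argo
    qed simp
  qed
next
  case False
  show ?thesis by (rule that[of 0]) (use False in auto)
qed

text \<open>The square of the natural number \<open>N * d\<close> is at least the number itself, so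
  Gaussian decay in the distance becomes geometric decay in the index, with a ratio that a large
  \<open>N\<close> makes small.\<close>

lemma exp_neg_square_le_power:
  fixes \<alpha> t :: real
  assumes \<alpha>: "\<alpha> > 0" and t: "real (N * d) / 2 \<le> \<bar>t\<bar>"
  shows "exp (- \<alpha> / 2 * t\<^sup>2) \<le> (exp (- \<alpha> / 8) ^ N) ^ d"
proof -
  have "(real (N * d) / 2)\<^sup>2 \<le> \<bar>t\<bar>\<^sup>2" using t by (intro power_mono) auto
  then have 1: "real ((N * d) * (N * d)) / 4 \<le> t\<^sup>2" by (simp add: power2_eq_square)
  have "real (N * d) \<le> real ((N * d) * (N * d))" using le_square[of "N * d"] by (simp only: of_nat_le_iff)
  with 1 have "real (N * d) / 4 \<le> t\<^sup>2" by linarith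
  then have "\<alpha> / 2 * (real (N * d) / 4) \<le> \<alpha> / 2 * t\<^sup>2" using \<alpha> by (intro mult_left_mono) auto
  then have "- \<alpha> / 2 * t\<^sup>2 \<le> real (N * d) * (- \<alpha> / 8)" by simp
  then show ?thesis unfolding power_mult[symmetric] exp_of_nat_mult[symmetric] by simp
qed

text \<open>The peaks are \<open>N\<close> apart. The term nearest to Im z is at most the inverse
  weight, and the others decay geometrically on both sides of it.\<close>

lemma strip_sum_bounded:
  assumes \<alpha>: "\<alpha> > 0" and N: "N > 0"
  shows "\<exists>B. \<forall>z. fw \<alpha> 0 (strip_sum \<alpha> N s) z \<le> B"
proof (intro exI allI)
  fix z :: complex
  define X where "X = exp (- \<alpha> / 8) ^ N"
  have X: "0 \<le> X" "X < 1" unfolding X_def using \<alpha> N by (auto simp: power_less_one_iff)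
  define G where "G = exp (\<alpha> / 2 * (norm z)\<^sup>2)"
  have G: "G > 0" by (simp add: G_def)
  define a where "a k = strip_term \<alpha> (real (s + N * k)) z" for k
  obtain n :: nat where n: "\<And>k::nat. \<bar>real k - real n\<bar> / 2 \<le> \<bar>(Im z - real s) / real N - real k\<bar>"
    using nearest_nat by blast
  have a: "norm (a k) \<le> G * exp (- \<alpha> / 2 * (Im z - real (s + N * k))\<^sup>2)" for k
  proof -
    have "\<alpha> / 2 * (Im z - real (s + N * k))\<^sup>2 \<ge> 0" using \<alpha> by simp
    then have "- \<alpha> * (Im z - real (s + N * k))\<^sup>2 \<le> - \<alpha> / 2 * (Im z - real (s + N * k))\<^sup>2" by simp
    then show ?thesis unfolding a_def norm_strip_term G_def by (intro mult_left_mono) auto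
  qed
  have tail: "norm (a k) \<le> G * X ^ ((k - n) + (n - k))" for k
  proof -
    have d: "real ((k - n) + (n - k)) = \<bar>real k - real n\<bar>" by linarith
    have "real N * (\<bar>real k - real n\<bar> / 2) \<le> real N * \<bar>(Im z - real s) / real N - real k\<bar>"
      by (intro mult_left_mono n) auto
    also have "\<dots> = \<bar>real N * ((Im z - real s) / real N - real k)\<bar>" by (simp add: abs_mult)
    also have "real N * ((Im z - real s) / real N - real k) = Im z - real (s + N * k)"
      using N by (simp add: field_simps)
    finally have "real (N * ((k - n) + (n - k))) / 2 \<le> \<bar>Im z - real (s + N * k)\<bar>"
      unfolding of_nat_mult d by simp
    from exp_neg_square_le_power[OF \<alpha> this] show ?thesis
      using G by (intro order_trans[OF a] mult_left_mono) (auto simp: X_def)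
  qed
  have "norm (suminf a - a n) \<le> G * (2 * X / (1 - X))"
    using G tail by (intro suminf_geometric_tail X) auto
  moreover have "norm (a n) \<le> G" using tail[of n] by simp
  ultimately have "norm (suminf a) \<le> G * (1 + 2 * X / (1 - X))"
    using norm_triangle_ineq[of "suminf a - a n" "a n"] by (simp add: algebra_simps)
  then have "norm (strip_sum \<alpha> N s z) * exp (- (\<alpha> / 2) * (norm z)\<^sup>2)
      \<le> (G * (1 + 2 * X / (1 - X))) * exp (- (\<alpha> / 2) * (norm z)\<^sup>2)"
    unfolding strip_sum_def a_def by (intro mult_right_mono) auto
  also have "\<dots> = (G * exp (- (\<alpha> / 2) * (norm z)\<^sup>2)) * (1 + 2 * X / (1 - X))" by (simp only: mult_ac)
  also have "G * exp (- (\<alpha> / 2) * (norm z)\<^sup>2) = 1" unfolding G_def exp_add[symmetric] by simp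
  finally show "fw \<alpha> 0 (strip_sum \<alpha> N s) z \<le> 1 + 2 * (exp (- \<alpha> / 8) ^ N) / (1 - exp (- \<alpha> / 8) ^ N)"
    by (simp add: fw_def X_def)
qed

text \<open>In the sum over the residue class of \<open>m\<close>, the term with index
  \<open>m div N\<close> peaks at height exactly \<open>m\<close>. Before division by 1 + |z|, its
  weighted derivative is at least \<alpha> exp (- \<alpha> / 4) |z| / 2, and the smallness
  conditions keep all other terms together below half of this.\<close>

lemma fw_deriv_strip_sum_ge:
  assumes \<alpha>: "\<alpha> > 0" and N: "N > 0" and small: "exp (- \<alpha> / 8) ^ N \<le> 1/2"
    "16 * exp (2 / \<alpha>) * exp (- \<alpha> / 8) ^ N \<le> exp (- \<alpha> / 4)"
    and z: "norm z \<ge> 2" and m: "\<bar>Im z - real m\<bar> \<le> 1/2"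
  shows "\<alpha> / 8 * exp (- \<alpha> / 4) \<le> fw \<alpha> 1 (deriv (strip_sum \<alpha> N (m mod N))) z"
proof -
  define X where "X = exp (- \<alpha> / 8) ^ N"
  have X: "0 \<le> X" "X \<le> 1/2" unfolding X_def using small by auto
  define G where "G = exp (\<alpha> / 2 * (norm z)\<^sup>2)"
  have G: "G > 0" by (simp add: G_def)
  define n where "n = m div N"
  define y where "y k = real (m mod N + N * k)" for k
  have yn: "y n = real m" unfolding y_def n_def by (simp add: algebra_simps flip: of_nat_mult of_nat_add)
  define a where "a k = of_real \<alpha> * (z - 2 * \<i> * of_real (y k)) * strip_term \<alpha> (y k) z" for k
  have na: "norm (a k) = \<alpha> * norm (z - 2 * \<i> * of_real (y k)) * (G * exp (- \<alpha> * (Im z - y k)\<^sup>2))" for k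
    unfolding a_def norm_mult norm_strip_term G_def using \<alpha> by simp
  have deriv: "deriv (strip_sum \<alpha> N (m mod N)) z = suminf a"
    unfolding a_def y_def by (rule DERIV_imp_deriv[OF strip_sum_has_derivative[OF \<alpha> N]])
  define D where "D = \<alpha> * norm z * exp (2 / \<alpha>) * G"
  have D: "D \<ge> 0" unfolding D_def using \<alpha> G by simp
  have tail: "norm (a k) \<le> D * X ^ ((k - n) + (n - k))" if k: "k \<noteq> n" for k
  proof -
    define t where "t = \<bar>Im z - y k\<bar>"
    have dd: "real ((k - n) + (n - k)) = \<bar>real k - real n\<bar>" by linarith
    have "y k - y n = real N * (real k - real n)" unfolding y_def by (simp add: algebra_simps)
    then have "\<bar>y k - real m\<bar> = real (N * ((k - n) + (n - k)))"
      unfolding yn of_nat_mult dd by (simp add: abs_mult)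
    moreover have "1 \<le> N * ((k - n) + (n - k))" using N k by (cases "k < n") auto
    then have "1 \<le> real (N * ((k - n) + (n - k)))" by linarith
    \<comment> \<open>The distance to another peak is at least N |k - n| - 1/2, and since N |k - n|
      \<ge> 1 half of that product survives.\<close>
    ultimately have "real (N * ((k - n) + (n - k))) / 2 \<le> \<bar>Im z - y k\<bar>" using m by linarith
    from exp_neg_square_le_power[OF \<alpha> this]
    have e: "exp (- \<alpha> / 2 * t\<^sup>2) \<le> X ^ ((k - n) + (n - k))" unfolding X_def t_def by simp
    have "norm (z - 2 * \<i> * of_real (y k)) \<le> norm z + 2 * t"
      unfolding t_def by (rule norm_minus_two_imaginary_le)
    also have "\<dots> \<le> norm z * (1 + 2 * t)"
    proof -
      have "1 * (2 * t) \<le> norm z * (2 * t)" using z by (intro mult_right_mono) (auto simp: t_def)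
      then show ?thesis by (simp add: algebra_simps)
    qed
    also have "\<dots> \<le> norm z * (exp (2 / \<alpha>) * exp (\<alpha> / 2 * t\<^sup>2))"
      using linear_le_exp_square[of "\<alpha> / 2" t] \<alpha> by (intro mult_left_mono) auto
    finally have "norm (a k) \<le> \<alpha> * (norm z * (exp (2 / \<alpha>) * exp (\<alpha> / 2 * t\<^sup>2))) * (G * exp (- \<alpha> * t\<^sup>2))"
      unfolding na using \<alpha> G by (intro mult_mono mult_left_mono) (auto simp: t_def)
    also have "\<dots> = D * exp (\<alpha> / 2 * t\<^sup>2 + - \<alpha> * t\<^sup>2)" unfolding D_def exp_add by (simp only: mult_ac)
    also have "\<alpha> / 2 * t\<^sup>2 + - \<alpha> * t\<^sup>2 = - \<alpha> / 2 * t\<^sup>2" by (simp add: field_simps)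
    also have "D * exp (- \<alpha> / 2 * t\<^sup>2) \<le> D * X ^ ((k - n) + (n - k))" using e D by (rule mult_left_mono)
    finally show ?thesis .
  qed
  have "norm (suminf a - a n) \<le> D * (2 * X / (1 - X))"
    using D tail X by (intro suminf_geometric_tail) auto
  also have "\<dots> \<le> D * (4 * X)"
  proof (intro mult_left_mono D)
    have "2 * X \<le> 4 * X * (1 - X)" using mult_left_mono[OF X(2) X(1)] by (simp add: algebra_simps)
    then show "2 * X / (1 - X) \<le> 4 * X" using X by (simp add: divide_le_eq)
  qed
  also have "\<dots> = \<alpha> * norm z * G * (exp (2 / \<alpha>) * (4 * X))" unfolding D_def by simp
  also have "\<dots> \<le> \<alpha> * norm z * G * (exp (- \<alpha> / 4) / 4)"
    using small(2) \<alpha> G unfolding X_def by (intro mult_left_mono) auto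
  finally have 1: "norm (suminf a - a n) \<le> \<alpha> * norm z * G * (exp (- \<alpha> / 4) / 4)" .
  \<comment> \<open>Here |z| \<ge> 2 enters: the linear factor differs in modulus from |z| by at
    most 1, that is, by at most half of |z|.\<close>
  have "norm z / 2 \<le> norm (z - 2 * \<i> * of_real (y n))"
  proof -
    have "\<bar>Im z - y n\<bar> \<le> 1/2" using m unfolding yn .
    with norm_minus_two_imaginary_ge[of z "y n"] z show ?thesis by argo
  qed
  moreover have "exp (- \<alpha> / 4) \<le> exp (- \<alpha> * (Im z - y n)\<^sup>2)"
  proof -
    have "\<bar>Im z - y n\<bar>\<^sup>2 \<le> (1/2)\<^sup>2" using m unfolding yn by (intro power_mono) auto
    then have "\<alpha> * (Im z - y n)\<^sup>2 \<le> \<alpha> * (1/4)" using \<alpha> by (intro mult_left_mono) (auto simp: power2_eq_square)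
    then show ?thesis by simp
  qed
  ultimately have "\<alpha> * (norm z / 2) * (G * exp (- \<alpha> / 4)) \<le> norm (a n)"
    unfolding na using \<alpha> G by (intro mult_mono mult_left_mono) auto
  then have 2: "\<alpha> * norm z * G * (exp (- \<alpha> / 4) / 2) \<le> norm (a n)" by (simp add: mult_ac)
  have half: "\<alpha> * norm z * G * (exp (- \<alpha> / 4) / 2)
    = \<alpha> * norm z * G * (exp (- \<alpha> / 4) / 4) + \<alpha> * norm z * G * (exp (- \<alpha> / 4) / 4)" by simp
  have "norm (a n) \<le> norm (suminf a) + norm (suminf a - a n)"
    using norm_triangle_ineq4[of "suminf a" "suminf a - a n"] by simp
  then have 3: "\<alpha> * norm z * G * (exp (- \<alpha> / 4) / 4) \<le> norm (suminf a)" using 1 2 half by linarith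
  have pos: "1 + norm z > 0" by (simp add: add_pos_nonneg)
  have "1 + norm z \<le> 2 * norm z" using z by simp
  then have "\<alpha> / 8 * exp (- \<alpha> / 4) * G * (1 + norm z) \<le> \<alpha> / 8 * exp (- \<alpha> / 4) * G * (2 * norm z)"
    using \<alpha> G by (intro mult_left_mono) auto
  also have "\<dots> = \<alpha> * norm z * G * (exp (- \<alpha> / 4) / 4)" by simp
  finally have "\<alpha> / 8 * exp (- \<alpha> / 4) * G * (1 + norm z) \<le> norm (suminf a)" using 3 by linarith
  then have "\<alpha> / 8 * exp (- \<alpha> / 4) * G \<le> norm (suminf a) / (1 + norm z)" using pos by (simp add: pos_le_divide_eq)
  then have "\<alpha> / 8 * exp (- \<alpha> / 4) * G * exp (- (\<alpha> / 2) * (norm z)\<^sup>2)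
    \<le> norm (suminf a) / (1 + norm z) * exp (- (\<alpha> / 2) * (norm z)\<^sup>2)" by (rule mult_right_mono) simp
  moreover have "G * exp (- (\<alpha> / 2) * (norm z)\<^sup>2) = 1" unfolding G_def exp_add[symmetric] by simp
  ultimately show ?thesis unfolding fw_def deriv by (simp add: mult.assoc)
qed

text \<open>The residue classes serve the points of modulus at least 2 in the closed upper half
  plane, and their reflections under z to - z those in the lower one. The identity covers the disc
  of radius 2, where the linear factor in the derivative of a strip term may vanish.\<close>

lemma fock_test_family:
  fixes \<alpha> :: real
  assumes \<alpha>: "\<alpha> > 0"
  obtains S c where "finite S" "c > 0"
    "\<And>f. f \<in> S \<Longrightarrow> f holomorphic_on UNIV"
    "\<And>f. f \<in> S \<Longrightarrow> \<exists>B. \<forall>z. fw \<alpha> 0 f z \<le> B"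
    "\<And>w. \<exists>f\<in>S. c \<le> fw \<alpha> 1 (deriv f) w"
proof -
  \<comment> \<open>Both smallness conditions of the lower bound at once; the first also excludes
    \<open>N = 0\<close>, for which the power would be 1.\<close>
  define \<epsilon> where "\<epsilon> = min (1/2) (exp (- \<alpha> / 4) / (16 * exp (2 / \<alpha>)))"
  have "\<epsilon> > 0" by (simp add: \<epsilon>_def)
  moreover have "exp (- \<alpha> / 8) < 1" using \<alpha> by simp
  ultimately obtain N where N: "exp (- \<alpha> / 8) ^ N < \<epsilon>" using real_arch_pow_inv by blast
  have small1: "exp (- \<alpha> / 8) ^ N \<le> 1/2" using N by (simp add: \<epsilon>_def)
  have "exp (- \<alpha> / 8) ^ N \<le> exp (- \<alpha> / 4) / (16 * exp (2 / \<alpha>))" using N by (simp add: \<epsilon>_def)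
  then have small2: "16 * exp (2 / \<alpha>) * exp (- \<alpha> / 8) ^ N \<le> exp (- \<alpha> / 4)"
    by (simp add: pos_le_divide_eq mult.commute)
  have N0: "N > 0" using small1 by (cases N) auto
  define f where "f s = strip_sum \<alpha> N s" for s
  define h where "h s = (\<lambda>z. f s (- z))" for s
  have fhol: "f s holomorphic_on UNIV" for s unfolding f_def by (rule strip_sum_holomorphic[OF \<alpha> N0])
  have hder: "(h s has_field_derivative deriv (f s) (- z) * (- 1)) (at z)" for s z
  proof -
    have "(f s has_field_derivative deriv (f s) (- z)) (at (- z))" by (rule holomorphic_derivI[OF fhol]) auto
    moreover have "(uminus has_field_derivative - 1) (at z)" by (auto intro!: derivative_eq_intros)
    ultimately show ?thesis unfolding h_def by (rule DERIV_chain2)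
  qed
  have hhol: "h s holomorphic_on UNIV" for s
    unfolding holomorphic_on_def field_differentiable_def using hder has_field_derivative_at_within by blast
  have fwh: "fw \<alpha> 0 (h s) z = fw \<alpha> 0 (f s) (- z)" for s z by (simp add: fw_def h_def)
  have fwh': "fw \<alpha> 1 (deriv (h s)) z = fw \<alpha> 1 (deriv (f s)) (- z)" for s z
    using DERIV_imp_deriv[OF hder] by (simp add: fw_def)
  \<comment> \<open>The second entry is a lower bound for the weighted derivative of the identity on
    the disc of radius 2.\<close>
  define c where "c = min (\<alpha> / 8 * exp (- \<alpha> / 4)) (exp (- 2 * \<alpha>) / 3)"
  define S where "S = insert (\<lambda>z. z) (f ` {..<N} \<union> h ` {..<N})"
  show ?thesis
  proof (rule that[of S c])
    show "finite S" by (simp add: S_def)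
    show "c > 0" using \<alpha> by (simp add: c_def)
    show "F holomorphic_on UNIV" if "F \<in> S" for F
      using that fhol hhol by (auto simp: S_def)
    show "\<exists>B. \<forall>z. fw \<alpha> 0 F z \<le> B" if F: "F \<in> S" for F
    proof -
      have bf: "\<exists>B. \<forall>z. fw \<alpha> 0 (f s) z \<le> B" for s unfolding f_def by (rule strip_sum_bounded[OF \<alpha> N0])
      have bh: "\<exists>B. \<forall>z. fw \<alpha> 0 (h s) z \<le> B" for s using bf[of s] unfolding fwh by blast
      have "fw \<alpha> 0 (\<lambda>z. z) z \<le> exp (2 / \<alpha>)" for z
      proof -
        have "1 + 2 * norm z \<le> exp (2 / \<alpha>) * exp (\<alpha> / 2 * (norm z)\<^sup>2)"
          using linear_le_exp_square[of "\<alpha> / 2" "norm z"] \<alpha> by simp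
        moreover have "norm z \<le> 1 + 2 * norm z" by simp
        ultimately have "norm z \<le> exp (2 / \<alpha>) * exp (\<alpha> / 2 * (norm z)\<^sup>2)" by linarith
        then have "norm z * exp (- (\<alpha> / 2) * (norm z)\<^sup>2)
          \<le> exp (2 / \<alpha>) * exp (\<alpha> / 2 * (norm z)\<^sup>2) * exp (- (\<alpha> / 2) * (norm z)\<^sup>2)"
          by (rule mult_right_mono) simp
        also have "\<dots> = exp (2 / \<alpha>)" unfolding mult.assoc exp_add[symmetric] by simp
        finally show ?thesis by (simp add: fw_def)
      qed
      then show ?thesis using F bf bh by (auto simp: S_def)
    qed
    show "\<exists>F\<in>S. c \<le> fw \<alpha> 1 (deriv F) w" for w
    proof (cases "norm w \<ge> 2")
      case False
      have d: "deriv (\<lambda>z. z) w = (1::complex)" by (simp add: deriv_ident)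
      have "(norm w)\<^sup>2 \<le> 2\<^sup>2" using False by (intro power_mono) auto
      then have "\<alpha> * (norm w)\<^sup>2 \<le> \<alpha> * 4" using \<alpha> by (intro mult_left_mono) auto
      then have e: "exp (- 2 * \<alpha>) \<le> exp (- (\<alpha> / 2) * (norm w)\<^sup>2)" by simp
      have "1 / 3 \<le> 1 / (1 + norm w)" using False by (intro divide_left_mono) (auto simp: add_pos_nonneg)
      from mult_mono[OF this e] have "exp (- 2 * \<alpha>) / 3 \<le> fw \<alpha> 1 (deriv (\<lambda>z. z)) w"
        unfolding fw_def d by simp
      then have "c \<le> fw \<alpha> 1 (deriv (\<lambda>z. z)) w" unfolding c_def by linarith
      then show ?thesis unfolding S_def by blast
    next
      case True
      have low: "c \<le> fw \<alpha> 1 (deriv (f (nat \<lfloor>Im v + 1/2\<rfloor> mod N))) v" if v: "Im v \<ge> 0" "norm v \<ge> 2" for v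
      proof -
        have "real (nat \<lfloor>Im v + 1/2\<rfloor>) = of_int \<lfloor>Im v + 1/2\<rfloor>" using v by simp
        then have "\<bar>Im v - real (nat \<lfloor>Im v + 1/2\<rfloor>)\<bar> \<le> 1/2"
          using floor_correct[of "Im v + 1/2"] by linarith
        from fw_deriv_strip_sum_ge[OF \<alpha> N0 small1 small2 v(2) this]
        show ?thesis unfolding f_def c_def by linarith
      qed
      have mem: "nat \<lfloor>Im v + 1/2\<rfloor> mod N \<in> {..<N}" for v using N0 by simp
      show ?thesis
      proof (cases "Im w \<ge> 0")
        case True
        then show ?thesis using low[of w] \<open>norm w \<ge> 2\<close> mem[of w] unfolding S_def by blast
      next
        case False
        then have "c \<le> fw \<alpha> 1 (deriv (h (nat \<lfloor>Im (- w) + 1/2\<rfloor> mod N))) w"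
          using low[of "- w"] \<open>norm w \<ge> 2\<close> unfolding fwh' by simp
        then show ?thesis using mem[of "- w"] unfolding S_def by blast
      qed
    qed
  qed
qed

section \<open>The operator\<close>

lemma T_op_integrand_holomorphic:
  assumes "g holomorphic_on UNIV" "\<phi> holomorphic_on UNIV" "f holomorphic_on UNIV"
  shows "(\<lambda>\<xi>. deriv f (\<phi> \<xi>) * g \<xi>) holomorphic_on UNIV"
proof -
  have "deriv f holomorphic_on UNIV" using assms(3) by (rule holomorphic_deriv) simp
  then have "(deriv f \<circ> \<phi>) holomorphic_on UNIV"
    by (intro holomorphic_on_compose_gen[OF assms(2)]) auto
  then show ?thesis using assms(1) by (auto simp: o_def intro!: holomorphic_on_mult)
qed

text \<open>An entire integrand has a primitive on the whole plane, and the integral over the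
  segment from 0 is the increment of that primitive.\<close>

lemma T_op_has_derivative:
  assumes "g holomorphic_on UNIV" "\<phi> holomorphic_on UNIV" "f holomorphic_on UNIV"
  shows "(T_op g \<phi> f has_field_derivative deriv f (\<phi> z) * g z) (at z)"
proof -
  obtain P where P: "\<And>x. (P has_field_derivative deriv f (\<phi> x) * g x) (at x)"
    using holomorphic_convex_primitive'[OF convex_UNIV open_UNIV T_op_integrand_holomorphic[OF assms]]
    by auto
  have "T_op g \<phi> f z = P z - P 0" for z
    unfolding T_op_def
    using contour_integral_primitive[of UNIV P "\<lambda>\<xi>. deriv f (\<phi> \<xi>) * g \<xi>" "linepath 0 z"] P
    by (intro contour_integral_unique) auto
  then have "T_op g \<phi> f = (\<lambda>z. P z - P 0)" by auto
  then show ?thesis using DERIV_diff[OF P DERIV_const] by simp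
qed

lemma T_op_0: "T_op g \<phi> f 0 = 0"
  by (simp add: T_op_def)

lemma T_op_holomorphic:
  assumes "g holomorphic_on UNIV" "\<phi> holomorphic_on UNIV" "f holomorphic_on UNIV"
  shows "T_op g \<phi> f holomorphic_on UNIV"
  unfolding holomorphic_on_def field_differentiable_def
  using T_op_has_derivative[OF assms] has_field_derivative_at_within by blast

text \<open>\<open>deriv\<close> and \<open>contour_integral\<close> are total functions; they are
  additive once differentiability and integrability are supplied, and both come from
  holomorphy.\<close>

lemma T_op_add:
  assumes g: "g holomorphic_on UNIV" and \<phi>: "\<phi> holomorphic_on UNIV"
    and f: "f holomorphic_on UNIV" and h: "h holomorphic_on UNIV"
  shows "T_op g \<phi> (\<lambda>z. f z + h z) = (\<lambda>z. T_op g \<phi> f z + T_op g \<phi> h z)"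
proof
  fix z
  have int: "(\<lambda>\<xi>. deriv u (\<phi> \<xi>) * g \<xi>) contour_integrable_on linepath 0 z" if "u holomorphic_on UNIV" for u
    using T_op_integrand_holomorphic[OF g \<phi> that]
    by (intro contour_integrable_continuous_linepath holomorphic_on_imp_continuous_on)
      (auto intro: holomorphic_on_subset)
  have "deriv (\<lambda>z. f z + h z) w = deriv f w + deriv h w" for w
    using f h by (intro deriv_add) (auto simp: holomorphic_on_imp_differentiable_at)
  then have "T_op g \<phi> (\<lambda>z. f z + h z) z
      = contour_integral (linepath 0 z) (\<lambda>\<xi>. deriv f (\<phi> \<xi>) * g \<xi> + deriv h (\<phi> \<xi>) * g \<xi>)"
    by (simp add: T_op_def distrib_right)
  also have "\<dots> = T_op g \<phi> f z + T_op g \<phi> h z"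
    unfolding T_op_def by (rule contour_integral_add[OF int[OF f] int[OF h]])
  finally show "T_op g \<phi> (\<lambda>z. f z + h z) z = T_op g \<phi> f z + T_op g \<phi> h z" .
qed

lemma T_op_cmult:
  assumes g: "g holomorphic_on UNIV" and \<phi>: "\<phi> holomorphic_on UNIV" and f: "f holomorphic_on UNIV"
  shows "T_op g \<phi> (\<lambda>z. c * f z) = (\<lambda>z. c * T_op g \<phi> f z)"
proof
  fix z
  have int: "(\<lambda>\<xi>. deriv f (\<phi> \<xi>) * g \<xi>) contour_integrable_on linepath 0 z"
    using T_op_integrand_holomorphic[OF g \<phi> f]
    by (intro contour_integrable_continuous_linepath holomorphic_on_imp_continuous_on)
      (auto intro: holomorphic_on_subset)
  have "deriv (\<lambda>z. c * f z) w = c * deriv f w" for w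
    using f by (intro deriv_cmult) (auto simp: holomorphic_on_imp_differentiable_at)
  then have "T_op g \<phi> (\<lambda>z. c * f z) z = contour_integral (linepath 0 z) (\<lambda>\<xi>. c * (deriv f (\<phi> \<xi>) * g \<xi>))"
    by (simp add: T_op_def mult.assoc)
  also have "\<dots> = c * T_op g \<phi> f z"
    unfolding T_op_def by (rule contour_integral_lmul[OF int])
  finally show "T_op g \<phi> (\<lambda>z. c * f z) z = c * T_op g \<phi> f z" .
qed

definition T_symbol :: "real \<Rightarrow> (complex \<Rightarrow> complex) \<Rightarrow> (complex \<Rightarrow> complex) \<Rightarrow> complex \<Rightarrow> real" where
  "T_symbol \<alpha> g \<phi> z = (1 + norm (\<phi> z)) / (1 + norm z) * norm (g z)
     * exp (\<alpha> / 2 * ((norm (\<phi> z))\<^sup>2 - (norm z)\<^sup>2))"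

lemma T_symbol_nonneg: "0 \<le> T_symbol \<alpha> g \<phi> z"
  by (simp add: T_symbol_def)

lemma continuous_T_symbol:
  assumes "g holomorphic_on UNIV" "\<phi> holomorphic_on UNIV"
  shows "continuous_on UNIV (T_symbol \<alpha> g \<phi>)"
  unfolding T_symbol_def using assms[THEN holomorphic_on_imp_continuous_on]
  by (intro continuous_intros) (auto simp: add_nonneg_eq_0_iff)

text \<open>An exact identity, hence good for upper and lower bounds: the factors in
  \<open>\<phi> z\<close> carried by the symbol cancel the weight of \<open>deriv f\<close> at
  \<open>\<phi> z\<close>.\<close>

lemma fw_deriv_T_op:
  assumes "g holomorphic_on UNIV" "\<phi> holomorphic_on UNIV" "f holomorphic_on UNIV"
  shows "fw \<alpha> 1 (deriv (T_op g \<phi> f)) z = fw \<alpha> 1 (deriv f) (\<phi> z) * T_symbol \<alpha> g \<phi> z"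
proof -
  have d: "deriv (T_op g \<phi> f) z = deriv f (\<phi> z) * g z"
    by (rule DERIV_imp_deriv[OF T_op_has_derivative[OF assms]])
  have p: "1 + norm (\<phi> z) \<noteq> 0" by (simp add: add_nonneg_eq_0_iff)
  have "fw \<alpha> 1 (deriv f) (\<phi> z) * T_symbol \<alpha> g \<phi> z
    = norm (deriv f (\<phi> z)) * norm (g z) / (1 + norm z) * ((1 + norm (\<phi> z)) / (1 + norm (\<phi> z)))
     * exp (- (\<alpha> / 2) * (norm (\<phi> z))\<^sup>2 + \<alpha> / 2 * ((norm (\<phi> z))\<^sup>2 - (norm z)\<^sup>2))"
    unfolding fw_def T_symbol_def exp_add by simp
  also have "- (\<alpha> / 2) * (norm (\<phi> z))\<^sup>2 + \<alpha> / 2 * ((norm (\<phi> z))\<^sup>2 - (norm z)\<^sup>2) = - (\<alpha> / 2) * (norm z)\<^sup>2"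
    by (simp add: right_diff_distrib)
  finally show ?thesis using p by (simp add: fw_def d norm_mult)
qed

section \<open>The spaces, norms and L^q conditions as bounds and nonnegative integrals\<close>

lemma fock_weight_eq:
  "norm (f z) powr q * exp (- (\<alpha> * q / 2) * (norm z)\<^sup>2) = fw \<alpha> 0 f z powr q"
proof -
  have "- (\<alpha> * q / 2) * (norm z)\<^sup>2 = - (\<alpha> / 2) * (norm z)\<^sup>2 * q" by simp
  then show ?thesis unfolding fw_def power_0 div_by_1 powr_mult exp_powr_real by (simp only:)
qed

lemma fock_space_finite_iff:
  assumes "q \<noteq> \<infinity>"
  shows "f \<in> fock_space \<alpha> q \<longleftrightarrow> f holomorphic_on UNIV \<and>
    (\<integral>\<^sup>+z. ennreal (fw \<alpha> 0 f z powr enn2real q) \<partial>lborel) < \<infinity>"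
proof -
  have "integrable lborel (\<lambda>z. fw \<alpha> 0 f z powr enn2real q) \<longleftrightarrow>
      (\<integral>\<^sup>+z. ennreal (fw \<alpha> 0 f z powr enn2real q) \<partial>lborel) < \<infinity>" if "f holomorphic_on UNIV"
    using fw_measurable[OF that] by (simp add: integrable_iff_bounded)
  then show ?thesis using assms unfolding fock_space_def fock_weight_eq by auto
qed

lemma fock_space_infinity_iff:
  "f \<in> fock_space \<alpha> \<infinity> \<longleftrightarrow> f holomorphic_on UNIV \<and> bdd_above (range (fw \<alpha> 0 f))"
  by (simp add: fock_space_def fw_def[abs_def])

lemma fock_norm_infinity: "fock_norm \<alpha> \<infinity> f = (SUP z. fw \<alpha> 0 f z)"
  by (simp add: fock_norm_def fw_def)

lemma fw_le_fock_norm_infinity: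
  assumes "f \<in> fock_space \<alpha> \<infinity>"
  shows "fw \<alpha> 0 f z \<le> fock_norm \<alpha> \<infinity> f"
  using assms unfolding fock_norm_infinity fock_space_infinity_iff by (auto intro: cSUP_upper)

lemma fock_norm_infinity_le:
  assumes "\<And>z. fw \<alpha> 0 f z \<le> B"
  shows "fock_norm \<alpha> \<infinity> f \<le> B"
  unfolding fock_norm_infinity using assms by (intro cSUP_least) auto

text \<open>The set where \<open>f\<close> exceeds \<open>C\<close> is open, and a nonempty open set
  is not null. This turns an essential bound on the symbol into a bound at every point.\<close>

lemma AE_lborel_continuous_le:
  fixes f :: "complex \<Rightarrow> real"
  assumes cont: "continuous_on UNIV f" and AE: "AE x in lborel. f x \<le> C"
  shows "f x \<le> C"
proof (rule ccontr)
  assume "\<not> f x \<le> C"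
  moreover have "open {y. C < f y}" using open_Collect_less[OF continuous_on_const cont] .
  ultimately have "\<not> negligible {y. C < f y}" 
    by (intro open_not_negligible) (auto simp: not_le intro: exI[of _ x])
  moreover have "{y. C < f y} \<in> null_sets lborel"
    using AE \<open>open {y. C < f y}\<close> by (subst AE_iff_null_sets) (auto simp: not_less borel_open)
  ultimately show False by (simp add: negligible_iff_null_sets null_sets_completionI)
qed

lemma in_Lq_finite_iff:
  assumes "q \<noteq> \<infinity>" and cont: "continuous_on UNIV M" and nn: "\<And>z::complex. 0 \<le> M z"
  shows "in_Lq lborel q M \<longleftrightarrow> (\<integral>\<^sup>+z. ennreal (M z powr enn2real q) \<partial>lborel) < \<infinity>"
proof -
  have "M \<in> borel_measurable borel" using cont by (rule borel_measurable_continuous_onI)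
  then show ?thesis using assms by (simp add: in_Lq_def integrable_iff_bounded)
qed

lemma in_Lq_infinity_iff:
  assumes cont: "continuous_on UNIV M" and nn: "\<And>z::complex. 0 \<le> M z"
  shows "in_Lq lborel \<infinity> M \<longleftrightarrow> (\<exists>C. \<forall>z. M z \<le> C)"
proof -
  have m: "M \<in> borel_measurable borel" using cont by (rule borel_measurable_continuous_onI)
  show ?thesis
  proof
    assume "in_Lq lborel \<infinity> M"
    then obtain C where "AE x in lborel. M x \<le> C" using nn by (auto simp: in_Lq_def)
    then show "\<exists>C. \<forall>z. M z \<le> C" using AE_lborel_continuous_le[OF cont] by blast
  next
    assume "\<exists>C. \<forall>z. M z \<le> C"
    then obtain C where "\<And>z. \<bar>M z\<bar> \<le> C" using nn by auto
    then have "AE x in lborel. \<bar>M x\<bar> \<le> C" by simp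
    then show "in_Lq lborel \<infinity> M" using m by (auto simp: in_Lq_def)
  qed
qed

section \<open>Weighted derivatives of images and the two implications\<close>

lemma fw_deriv_le_fock_norm:
  assumes \<alpha>: "\<alpha> > 0" and f: "f \<in> fock_space \<alpha> \<infinity>"
  shows "fw \<alpha> 1 (deriv f) z \<le> exp (3 * \<alpha> / 2) * fock_norm \<alpha> \<infinity> f"
proof -
  have "f holomorphic_on UNIV" using f by (simp add: fock_space_def)
  then obtain \<zeta> where "fw \<alpha> 1 (deriv f) z \<le> exp (3 * \<alpha> / 2) * fw \<alpha> 0 f \<zeta>"
    using fw_deriv_le_fw[OF \<alpha>] by blast
  also have "\<dots> \<le> exp (3 * \<alpha> / 2) * fock_norm \<alpha> \<infinity> f"
    by (intro mult_left_mono fw_le_fock_norm_infinity f) simp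
  finally show ?thesis .
qed

lemma fock_norm_infinity_nonneg:
  assumes "f \<in> fock_space \<alpha> \<infinity>"
  shows "0 \<le> fock_norm \<alpha> \<infinity> f"
  using fw_le_fock_norm_infinity[OF assms, of 0] fw_nonneg[of \<alpha> 0 f 0] by linarith

lemma fw_deriv_T_op_le:
  assumes g: "g holomorphic_on UNIV" and \<phi>: "\<phi> holomorphic_on UNIV" and \<alpha>: "\<alpha> > 0"
    and f: "f \<in> fock_space \<alpha> \<infinity>"
  shows "fw \<alpha> 1 (deriv (T_op g \<phi> f)) z \<le> exp (3 * \<alpha> / 2) * fock_norm \<alpha> \<infinity> f * T_symbol \<alpha> g \<phi> z"
proof -
  have hf: "f holomorphic_on UNIV" using f by (simp add: fock_space_def)
  show ?thesis unfolding fw_deriv_T_op[OF g \<phi> hf]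
    by (intro mult_right_mono fw_deriv_le_fock_norm[OF \<alpha> f] T_symbol_nonneg)
qed

text \<open>The norm of \<open>f\<close> enters as a constant in front of the symbol: after the r-th
  power it leaves the integral, and after the r-th root it is linear again.\<close>

lemma T_op_bounded_of_integrable:
  assumes g: "g holomorphic_on UNIV" and \<phi>: "\<phi> holomorphic_on UNIV" and \<alpha>: "\<alpha> > 0"
    and q: "q > 0" "q \<noteq> \<infinity>"
    and fin: "(\<integral>\<^sup>+z. ennreal (T_symbol \<alpha> g \<phi> z powr enn2real q) \<partial>lborel) < \<infinity>"
  shows "\<exists>C. \<forall>f\<in>fock_space \<alpha> \<infinity>. T_op g \<phi> f \<in> fock_space \<alpha> q \<and>
    fock_norm \<alpha> q (T_op g \<phi> f) \<le> C * fock_norm \<alpha> \<infinity> f"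
proof -
  define r where "r = enn2real q"
  have r: "r > 0" unfolding r_def using q by (cases q) auto
  obtain C where C: "C \<ge> 0" and LP:
    "\<And>F. F holomorphic_on UNIV \<Longrightarrow> F 0 = 0 \<Longrightarrow> (\<integral>\<^sup>+z. ennreal (fw \<alpha> 0 F z powr r) \<partial>lborel)
       \<le> ennreal C * (\<integral>\<^sup>+z. ennreal (fw \<alpha> 1 (deriv F) z powr r) \<partial>lborel)"
    using nn_integral_fw_le[OF r \<alpha>] by blast
  obtain I where I: "I \<ge> 0" "(\<integral>\<^sup>+z. ennreal (T_symbol \<alpha> g \<phi> z powr r) \<partial>lborel) = ennreal I"
    using fin unfolding r_def by (cases "\<integral>\<^sup>+z. ennreal (T_symbol \<alpha> g \<phi> z powr enn2real q) \<partial>lborel") auto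
  have [measurable]: "T_symbol \<alpha> g \<phi> \<in> borel_measurable borel"
    by (rule borel_measurable_continuous_onI[OF continuous_T_symbol[OF g \<phi>]])
  \<comment> \<open>The normalising factor of the norm, the Littlewood--Paley constant and the
    integral of the symbol; its r-th root enters the operator bound.\<close>
  define A where "A = \<alpha> * r / (2 * pi) * (C * I)"
  have A: "A \<ge> 0" unfolding A_def using \<alpha> r C I by simp
  define E where "E = exp (3 * \<alpha> / 2)"
  show ?thesis
  proof (intro exI ballI)
    fix f assume f: "f \<in> fock_space \<alpha> \<infinity>"
    define n where "n = fock_norm \<alpha> \<infinity> f"
    have n: "n \<ge> 0" unfolding n_def by (rule fock_norm_infinity_nonneg[OF f])
    have hf: "f holomorphic_on UNIV" using f by (simp add: fock_space_def)
    let ?F = "T_op g \<phi> f"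
    have hF: "?F holomorphic_on UNIV" by (rule T_op_holomorphic[OF g \<phi> hf])
    have "(\<integral>\<^sup>+z. ennreal (fw \<alpha> 1 (deriv ?F) z powr r) \<partial>lborel)
      \<le> (\<integral>\<^sup>+z. ennreal ((E * n) powr r) * ennreal (T_symbol \<alpha> g \<phi> z powr r) \<partial>lborel)"
    proof (rule nn_integral_mono)
      fix z
      have "fw \<alpha> 1 (deriv ?F) z powr r \<le> (E * n * T_symbol \<alpha> g \<phi> z) powr r"
        using fw_deriv_T_op_le[OF g \<phi> \<alpha> f, of z] r unfolding E_def n_def by (intro powr_mono2) auto
      also have "\<dots> = (E * n) powr r * T_symbol \<alpha> g \<phi> z powr r"
        by (rule powr_mult)
      finally show "ennreal (fw \<alpha> 1 (deriv ?F) z powr r)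
          \<le> ennreal ((E * n) powr r) * ennreal (T_symbol \<alpha> g \<phi> z powr r)"
        by (simp add: ennreal_mult'[symmetric] ennreal_leI)
    qed
    also have "\<dots> = ennreal ((E * n) powr r) * (\<integral>\<^sup>+z. ennreal (T_symbol \<alpha> g \<phi> z powr r) \<partial>lborel)"
      by (rule nn_integral_cmult) measurable
    also have "\<dots> = ennreal ((E * n) powr r * I)" unfolding I(2) by (simp add: ennreal_mult')
    finally have "(\<integral>\<^sup>+z. ennreal (fw \<alpha> 0 ?F z powr r) \<partial>lborel) \<le> ennreal C * ennreal ((E * n) powr r * I)"
      using LP[OF hF T_op_0] mult_left_mono[of _ _ "ennreal C"] by (meson order_trans zero_le)
    then have bd: "(\<integral>\<^sup>+z. ennreal (fw \<alpha> 0 ?F z powr r) \<partial>lborel) \<le> ennreal (C * ((E * n) powr r * I))"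
      using C by (simp add: ennreal_mult')
    then have mem: "?F \<in> fock_space \<alpha> q"
      unfolding fock_space_finite_iff[OF q(2)] r_def[symmetric] using hF
      by (auto intro: le_less_trans)
    \<comment> \<open>The norm is a Bochner integral while the estimates concern nonnegative ones;
      the finite bound \<open>bd\<close> is what lets \<open>enn2real\<close> preserve the
      inequality.\<close>
    have "(LINT z|lborel. fw \<alpha> 0 ?F z powr r) = enn2real (\<integral>\<^sup>+z. ennreal (fw \<alpha> 0 ?F z powr r) \<partial>lborel)"
      using fw_measurable[OF hF] by (intro integral_eq_nn_integral) auto
    also have "\<dots> \<le> C * ((E * n) powr r * I)"
      using enn2real_mono[OF bd] C I by (simp add: enn2real_ennreal)
    finally have "\<alpha> * r / (2 * pi) * (LINT z|lborel. fw \<alpha> 0 ?F z powr r) \<le> \<alpha> * r / (2 * pi) * (C * ((E * n) powr r * I))"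
      using \<alpha> r by (intro mult_left_mono) auto
    also have "\<dots> = A * (E * n) powr r" by (simp add: A_def)
    finally have "fock_norm \<alpha> q ?F \<le> (A * (E * n) powr r) powr (1 / r)"
      unfolding fock_norm_def fock_weight_eq r_def[symmetric]
      using q(2) \<alpha> r by (simp, intro powr_mono2) (auto intro!: mult_nonneg_nonneg integral_nonneg)
    also have "\<dots> = A powr (1 / r) * E * n"
      using A n r by (simp add: powr_mult powr_powr E_def)
    finally show "?F \<in> fock_space \<alpha> q \<and> fock_norm \<alpha> q ?F \<le> (A powr (1 / r) * E) * fock_norm \<alpha> \<infinity> f"
      using mem by (simp add: n_def)
  qed
qed

lemma T_op_bounded_of_bounded:
  assumes g: "g holomorphic_on UNIV" and \<phi>: "\<phi> holomorphic_on UNIV" and \<alpha>: "\<alpha> > 0"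
    and B: "\<And>z. T_symbol \<alpha> g \<phi> z \<le> B"
  shows "\<exists>C. \<forall>f\<in>fock_space \<alpha> \<infinity>. T_op g \<phi> f \<in> fock_space \<alpha> \<infinity> \<and>
    fock_norm \<alpha> \<infinity> (T_op g \<phi> f) \<le> C * fock_norm \<alpha> \<infinity> f"
proof (intro exI ballI)
  fix f assume f: "f \<in> fock_space \<alpha> \<infinity>"
  define n where "n = fock_norm \<alpha> \<infinity> f"
  have n: "n \<ge> 0" unfolding n_def by (rule fock_norm_infinity_nonneg[OF f])
  have hf: "f holomorphic_on UNIV" using f by (simp add: fock_space_def)
  have B0: "B \<ge> 0" using B[of 0] T_symbol_nonneg[of \<alpha> g \<phi> 0] by linarith
  have hF: "T_op g \<phi> f holomorphic_on UNIV" by (rule T_op_holomorphic[OF g \<phi> hf])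
  have d: "fw \<alpha> 1 (deriv (T_op g \<phi> f)) w \<le> exp (3 * \<alpha> / 2) * n * B" for w
  proof -
    have "fw \<alpha> 1 (deriv (T_op g \<phi> f)) w \<le> exp (3 * \<alpha> / 2) * n * T_symbol \<alpha> g \<phi> w"
      unfolding n_def by (rule fw_deriv_T_op_le[OF g \<phi> \<alpha> f])
    also have "\<dots> \<le> exp (3 * \<alpha> / 2) * n * B" using n by (intro mult_left_mono B) auto
    finally show ?thesis .
  qed
  \<comment> \<open>A bounded symbol bounds the weighted derivative by one constant on the whole
    segment: the growth rate is \<open>\<gamma> = 0\<close>.\<close>
  have le: "fw \<alpha> 0 (T_op g \<phi> f) z \<le> exp (3 * \<alpha> / 2) * n * B * (2 + 2 / (\<alpha> / 2 - 0))" for z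
    using d \<alpha> n B0 by (intro fw_le_of_fw_deriv[OF hF T_op_0]) auto
  have "T_op g \<phi> f \<in> fock_space \<alpha> \<infinity>"
    unfolding fock_space_infinity_iff using hF le by (auto intro!: bdd_aboveI2)
  moreover have "fock_norm \<alpha> \<infinity> (T_op g \<phi> f) \<le> (exp (3 * \<alpha> / 2) * B * (2 + 2 / (\<alpha> / 2 - 0))) * n"
    using fock_norm_infinity_le[OF le] by (simp only: mult_ac)
  ultimately show "T_op g \<phi> f \<in> fock_space \<alpha> \<infinity> \<and> fock_norm \<alpha> \<infinity> (T_op g \<phi> f)
    \<le> (exp (3 * \<alpha> / 2) * B * (2 + 2 / (\<alpha> / 2 - 0))) * fock_norm \<alpha> \<infinity> f"
    by (simp add: n_def)
qed

text \<open>The test function that is large at \<open>\<phi> z\<close> varies with \<open>z\<close>.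
  As the family is finite, this choice is replaced by a sum over all members, each of which
  contributes a finite bound or a finite integral.\<close>

lemma T_symbol_in_Lq_of_T_op:
  assumes g: "g holomorphic_on UNIV" and \<phi>: "\<phi> holomorphic_on UNIV" and \<alpha>: "\<alpha> > 0" and q: "q > 0"
    and T: "\<And>f. f \<in> fock_space \<alpha> \<infinity> \<Longrightarrow> T_op g \<phi> f \<in> fock_space \<alpha> q"
  shows "in_Lq lborel q (T_symbol \<alpha> g \<phi>)"
proof -
  obtain S c where S: "finite S" "c > 0" "\<And>f. f \<in> S \<Longrightarrow> f holomorphic_on UNIV"
    and bdd: "\<And>f. f \<in> S \<Longrightarrow> \<exists>B. \<forall>z. fw \<alpha> 0 f z \<le> B"
    and low: "\<And>w. \<exists>f\<in>S. c \<le> fw \<alpha> 1 (deriv f) w"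
    using fock_test_family[OF \<alpha>] by blast
  define v where "v f z = fw \<alpha> 1 (deriv (T_op g \<phi> f)) z" for f z
  have hol: "T_op g \<phi> f holomorphic_on UNIV" if "f \<in> S" for f
    by (rule T_op_holomorphic[OF g \<phi> S(3)[OF that]])
  have mem: "T_op g \<phi> f \<in> fock_space \<alpha> q" if "f \<in> S" for f
    using S(3)[OF that] bdd[OF that] by (intro T, unfold fock_space_infinity_iff) (auto intro: bdd_aboveI2)
  have key: "\<exists>f\<in>S. T_symbol \<alpha> g \<phi> z \<le> v f z / c" for z
  proof -
    obtain f where f: "f \<in> S" "c \<le> fw \<alpha> 1 (deriv f) (\<phi> z)" using low by blast
    have "c * T_symbol \<alpha> g \<phi> z \<le> v f z"
      unfolding v_def fw_deriv_T_op[OF g \<phi> S(3)[OF f(1)]] by (intro mult_right_mono f T_symbol_nonneg)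
    then show ?thesis using f S(2) by (auto simp: pos_le_divide_eq mult.commute)
  qed
  note cont = continuous_T_symbol[OF g \<phi>]
  show ?thesis
  proof (cases "q = \<infinity>")
    case True
    have "\<exists>B. \<forall>z. v f z \<le> B" if f: "f \<in> S" for f
      using fw_deriv_le_fock_norm[OF \<alpha>, of "T_op g \<phi> f"] mem[OF f] True unfolding v_def by blast
    then obtain B where B: "\<And>f z. f \<in> S \<Longrightarrow> v f z \<le> B f" by metis
    have "T_symbol \<alpha> g \<phi> z \<le> (\<Sum>f\<in>S. B f / c)" for z
    proof -
      obtain f where f: "f \<in> S" "T_symbol \<alpha> g \<phi> z \<le> v f z / c" using key by blast
      note f(2)
      also have "v f z / c \<le> B f / c" using B[OF f(1)] S(2) by (intro divide_right_mono) auto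
      also have "\<dots> \<le> (\<Sum>f\<in>S. B f / c)"
      proof (rule member_le_sum[OF f(1) _ S(1)])
        fix h assume "h \<in> S - {f}"
        then have "h \<in> S" by simp
        from B[OF this, of 0] have "0 \<le> B h"
          using fw_nonneg[of \<alpha> 1 "deriv (T_op g \<phi> h)" 0] unfolding v_def by linarith
        then show "0 \<le> B h / c" using S(2) by simp
      qed
      finally show ?thesis .
    qed
    then show ?thesis unfolding True in_Lq_infinity_iff[OF cont T_symbol_nonneg] by blast
  next
    case False
    define r where "r = enn2real q"
    have r: "r > 0" unfolding r_def using q False by (cases q) auto
    obtain C where C: "C \<ge> 0" and LP:
      "\<And>F. F holomorphic_on UNIV \<Longrightarrow> (\<integral>\<^sup>+z. ennreal (fw \<alpha> 1 (deriv F) z powr r) \<partial>lborel)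
         \<le> ennreal C * (\<integral>\<^sup>+z. ennreal (fw \<alpha> 0 F z powr r) \<partial>lborel)"
      using nn_integral_fw_deriv_le[OF r \<alpha>] by blast
    have fin: "(\<integral>\<^sup>+z. ennreal (v f z powr r) \<partial>lborel) < \<infinity>" if f: "f \<in> S" for f
    proof -
      have "(\<integral>\<^sup>+z. ennreal (fw \<alpha> 0 (T_op g \<phi> f) z powr r) \<partial>lborel) < \<infinity>"
        using mem[OF f] unfolding fock_space_finite_iff[OF False] r_def by blast
      then have "ennreal C * (\<integral>\<^sup>+z. ennreal (fw \<alpha> 0 (T_op g \<phi> f) z powr r) \<partial>lborel) < \<infinity>"
        by (simp add: ennreal_mult_less_top)
      then show ?thesis using LP[OF hol[OF f]] unfolding v_def by (rule le_less_trans[rotated])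
    qed
    have meas: "(\<lambda>z. ennreal (v f z powr r)) \<in> borel_measurable lborel" if f: "f \<in> S" for f
    proof -
      have "deriv (T_op g \<phi> f) holomorphic_on UNIV" using hol[OF f] by (rule holomorphic_deriv) simp
      then have [measurable]: "v f \<in> borel_measurable borel" unfolding v_def[abs_def] by (rule fw_measurable)
      show ?thesis by measurable
    qed
    have "(\<integral>\<^sup>+z. ennreal (T_symbol \<alpha> g \<phi> z powr r) \<partial>lborel)
      \<le> (\<integral>\<^sup>+z. (\<Sum>f\<in>S. ennreal ((1 / c) powr r) * ennreal (v f z powr r)) \<partial>lborel)"
    proof (rule nn_integral_mono)
      fix z
      obtain f where f: "f \<in> S" "T_symbol \<alpha> g \<phi> z \<le> v f z / c" using key by blast
      have "T_symbol \<alpha> g \<phi> z powr r \<le> ((1 / c) * v f z) powr r"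
        using f r T_symbol_nonneg by (intro powr_mono2) auto
      also have "\<dots> = (1 / c) powr r * v f z powr r"
        by (rule powr_mult)
      finally have "ennreal (T_symbol \<alpha> g \<phi> z powr r) \<le> ennreal ((1 / c) powr r) * ennreal (v f z powr r)"
        by (simp add: ennreal_mult'[symmetric] ennreal_leI)
      \<comment> \<open>Passing to the sum after the power has been taken works alike for
        \<open>r\<close> below and above 1.\<close>
      also have "\<dots> \<le> (\<Sum>f\<in>S. ennreal ((1 / c) powr r) * ennreal (v f z powr r))"
        using member_le_sum[OF f(1) _ S(1), of "\<lambda>f. ennreal ((1 / c) powr r) * ennreal (v f z powr r)"] by simp
      finally show "ennreal (T_symbol \<alpha> g \<phi> z powr r)
        \<le> (\<Sum>f\<in>S. ennreal ((1 / c) powr r) * ennreal (v f z powr r))" .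
    qed
    also have "\<dots> = (\<Sum>f\<in>S. \<integral>\<^sup>+z. ennreal ((1 / c) powr r) * ennreal (v f z powr r) \<partial>lborel)"
      by (intro nn_integral_sum borel_measurable_times_ennreal meas) auto
    also have "\<dots> = (\<Sum>f\<in>S. ennreal ((1 / c) powr r) * (\<integral>\<^sup>+z. ennreal (v f z powr r) \<partial>lborel))"
      by (intro sum.cong refl nn_integral_cmult meas)
    also have "\<dots> < \<infinity>"
      using fin S(1) by (auto simp: ennreal_mult_less_top less_top)
    finally show ?thesis
      unfolding in_Lq_finite_iff[OF False cont T_symbol_nonneg] r_def .
  qed
qed

theorem corollary4p4:
  fixes g \<phi> :: "complex \<Rightarrow> complex" and \<alpha> :: real and q :: ennreal
  assumes "g holomorphic_on UNIV" and "\<phi> holomorphic_on UNIV"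
    and "\<alpha> > 0" and "q > 0"
  shows "fock_bounded_operator \<alpha> \<infinity> q (T_op g \<phi>) \<longleftrightarrow>
    in_Lq (lborel :: complex measure) q
      (\<lambda>z. (1 + norm (\<phi> z)) / (1 + norm z) * norm (g z)
             * exp (\<alpha> / 2 * ((norm (\<phi> z))\<^sup>2 - (norm z)\<^sup>2)))"
  unfolding T_symbol_def[symmetric]
proof
  assume "fock_bounded_operator \<alpha> \<infinity> q (T_op g \<phi>)"
  then show "in_Lq lborel q (T_symbol \<alpha> g \<phi>)"
    by (intro T_symbol_in_Lq_of_T_op assms) (simp add: fock_bounded_operator_def)
next
  assume L: "in_Lq lborel q (T_symbol \<alpha> g \<phi>)"
  note cont = continuous_T_symbol[OF assms(1,2)]
  have "\<exists>C. \<forall>f\<in>fock_space \<alpha> \<infinity>. T_op g \<phi> f \<in> fock_space \<alpha> q \<and>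
    fock_norm \<alpha> q (T_op g \<phi> f) \<le> C * fock_norm \<alpha> \<infinity> f"
  proof (cases "q = \<infinity>")
    case True
    obtain B where "\<And>z. T_symbol \<alpha> g \<phi> z \<le> B"
      using L unfolding True in_Lq_infinity_iff[OF cont T_symbol_nonneg] by blast
    then show ?thesis unfolding True by (rule T_op_bounded_of_bounded[OF assms(1-3)])
  next
    case False
    then show ?thesis using L unfolding in_Lq_finite_iff[OF False cont T_symbol_nonneg]
      by (intro T_op_bounded_of_integrable assms)
  qed
  moreover have "f holomorphic_on UNIV" if "f \<in> fock_space \<alpha> \<infinity>" for f
    using that by (simp add: fock_space_def)
  ultimately show "fock_bounded_operator \<alpha> \<infinity> q (T_op g \<phi>)"
    unfolding fock_bounded_operator_def
    using T_op_add[OF assms(1,2)] T_op_cmult[OF assms(1,2)] by blast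
qed

end
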